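(* Let $(Y_t)$ be a recurrent continuous diffusion process with $Y_0=0$, and let $s$ be the continuous and strictly increasing function with $s(0)=0$, $\lim_{x\to+\infty}s(x)=+\infty$, $\lim_{x\to-\infty}s(x)=-\infty$, such that $s(Y_t)$ is a continuous local martingale. Let $\overline{Y}_t=\sup_{u\le t}Y_u$. Let $\theta$ be a Borel function with $\theta(x)>0$ for all $x>0$, and define the stopping time $$T=\inf\{t:\ \overline{Y}_t-Y_t\ge\theta(\overline{Y}_t)\}.$$ Assume that $T<\infty$ a.s. Then the law of $\overline{Y}_T$ is given by $$\mathbb{P}(\overline{Y}_T>x)=\exp\left(-\int_0^x\frac{ds(z)}{s(z)-s(z-\theta(z))}\right).$$ In particular, when $\theta(x)\equiv a$ with $a>0$, $$\mathbb{P}(\overline{Y}_T>x)=\exp\left(-\int_0^x\frac{ds(z)}{s(z)-s(z-a)}\right).$$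
   Context: The existence of the function $s$ (the scale function of $Y$) follows from the general theory of recurrent one-dimensional diffusion processes. $ds(z)$ denotes the Stieltjes measure of $s$.
   Formalization: For general θ the formula is asserted at those x ≥ 0 where the integral up to x is infinite, or where θ(0) > 0 and the integral up to some y > x is finite; at other x it is false (e.g. Brownian motion with θ(x)=√|x| has T=0). *)

theory Defs
  imports "HOL-Probability.Probability"
begin

text \<open>Time is \<open>[0,\<infinity>)\<close>, represented by the type \<^typ>\<open>real\<close>; a filtration indexed by \<open>[0,\<infinity>)\<close> is
  extended to negative times by \<open>F t = F 0\<close>. The usual conditions are not required.\<close>

locale filtered_prob_space = prob_space M + filtration "space M" F
  for M :: "'a measure" and F :: "real \<Rightarrow> 'a measure" +
  assumes sets_F_subset: "\<And>t. sets (F t) \<subseteq> sets M"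

definition adapted :: "(real \<Rightarrow> 'a measure) \<Rightarrow> (real \<Rightarrow> 'a \<Rightarrow> real) \<Rightarrow> bool" where
  "adapted F X \<longleftrightarrow> (\<forall>t\<ge>0. X t \<in> borel_measurable (F t))"

definition continuous_paths :: "'a measure \<Rightarrow> (real \<Rightarrow> 'a \<Rightarrow> real) \<Rightarrow> bool" where
  "continuous_paths M X \<longleftrightarrow> (\<forall>\<omega>\<in>space M. continuous_on {0..} (\<lambda>t. X t \<omega>))"

definition martingale ::
  "'a measure \<Rightarrow> (real \<Rightarrow> 'a measure) \<Rightarrow> (real \<Rightarrow> 'a \<Rightarrow> real) \<Rightarrow> bool" where
  "martingale M F X \<longleftrightarrow>
     adapted F X \<and> (\<forall>t\<ge>0. integrable M (X t)) \<and>
     (\<forall>u\<ge>0. \<forall>t\<ge>u. AE \<omega> in M. real_cond_exp M (F u) (X t) \<omega> = X u \<omega>)"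

text \<open>The localizing stopping times may be taken finite (replace \<open>\<tau> n\<close> by \<open>min (\<tau> n) n\<close>).\<close>

definition continuous_local_martingale ::
  "'a measure \<Rightarrow> (real \<Rightarrow> 'a measure) \<Rightarrow> (real \<Rightarrow> 'a \<Rightarrow> real) \<Rightarrow> bool" where
  "continuous_local_martingale M F X \<longleftrightarrow>
     adapted F X \<and> continuous_paths M X \<and>
     (\<exists>\<tau> :: nat \<Rightarrow> 'a \<Rightarrow> real.
        (\<forall>n. stopping_time F (\<tau> n)) \<and> (\<forall>n. \<forall>\<omega>\<in>space M. 0 \<le> \<tau> n \<omega>) \<and>
        (AE \<omega> in M. incseq (\<lambda>n. \<tau> n \<omega>) \<and> filterlim (\<lambda>n. \<tau> n \<omega>) at_top sequentially) \<and>
        (\<forall>n. martingale M F (\<lambda>t \<omega>. X (min t (\<tau> n \<omega>)) \<omega> - X 0 \<omega>)))"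

definition transition_semigroup :: "(real \<Rightarrow> real \<Rightarrow> real measure) \<Rightarrow> bool" where
  "transition_semigroup K \<longleftrightarrow>
     (\<forall>t\<ge>0. K t \<in> borel \<rightarrow>\<^sub>M prob_algebra borel) \<and>
     (\<forall>x. K 0 x = return borel x) \<and>
     (\<forall>t\<ge>0. \<forall>u\<ge>0. \<forall>x. K (t + u) x = K t x \<bind> K u)"

text \<open>Requiring the strong Markov property at finite stopping times gives it on \<open>{\<tau> < \<infinity>}\<close> for
  arbitrary \<open>\<tau>\<close>, by applying it to \<open>min \<tau> n\<close>.\<close>

definition strong_markov ::
  "'a measure \<Rightarrow> (real \<Rightarrow> 'a measure) \<Rightarrow> (real \<Rightarrow> real \<Rightarrow> real measure) \<Rightarrow>
   (real \<Rightarrow> 'a \<Rightarrow> real) \<Rightarrow> bool" where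
  "strong_markov M F K Y \<longleftrightarrow>
     (\<forall>\<tau>. stopping_time F \<tau> \<longrightarrow> (\<forall>\<omega>\<in>space M. 0 \<le> \<tau> \<omega>) \<longrightarrow>
       (\<forall>t\<ge>0. \<forall>A\<in>sets borel. AE \<omega> in M.
          real_cond_exp M (filtration.pre_sigma (space M) F \<tau>)
            (\<lambda>\<omega>'. indicator A (Y (\<tau> \<omega>' + t) \<omega>')) \<omega>
          = measure (K t (Y (\<tau> \<omega>) \<omega>)) A))"

definition diffusion ::
  "'a measure \<Rightarrow> (real \<Rightarrow> 'a measure) \<Rightarrow> (real \<Rightarrow> 'a \<Rightarrow> real) \<Rightarrow> bool" where
  "diffusion M F Y \<longleftrightarrow>
     adapted F Y \<and> continuous_paths M Y \<and>
     (\<exists>K. transition_semigroup K \<and> strong_markov M F K Y)"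

text \<open>For a diffusion, visiting every point at arbitrarily large times is the same as hitting
  every point almost surely from every starting point (by the strong Markov property).\<close>

definition recurrent :: "'a measure \<Rightarrow> (real \<Rightarrow> 'a \<Rightarrow> real) \<Rightarrow> bool" where
  "recurrent M Y \<longleftrightarrow> (\<forall>y. AE \<omega> in M. \<forall>t\<ge>0. \<exists>u\<ge>t. Y u \<omega> = y)"

definition running_sup :: "(real \<Rightarrow> 'a \<Rightarrow> real) \<Rightarrow> real \<Rightarrow> 'a \<Rightarrow> real" where
  "running_sup Y t \<omega> = (SUP u\<in>{0..t}. Y u \<omega>)"

definition drawdown_time :: "(real \<Rightarrow> 'a \<Rightarrow> real) \<Rightarrow> (real \<Rightarrow> real) \<Rightarrow> 'a \<Rightarrow> ereal" where
  "drawdown_time Y \<theta> \<omega> =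
     (INF t\<in>{t. 0 \<le> t \<and> running_sup Y t \<omega> - Y t \<omega> \<ge> \<theta> (running_sup Y t \<omega>)}. ereal t)"

text \<open>\<open>drawdown_time\<close> is \<open>\<infinity>\<close> if the set is empty. The set contains \<open>t = 0\<close> when \<open>\<theta> 0 \<le> 0\<close> and
  \<open>Y 0 = 0\<close>, so positivity of \<open>\<theta>\<close> on the open half-line alone does not prevent the time from
  being identically 0.\<close>

text \<open>The integral is nonnegative and may be infinite (for instance when \<open>\<theta>\<close> tends to 0 fast
  at some point), hence it is \<^typ>\<open>ennreal\<close>-valued, with \<open>exp (-\<infinity>) = 0\<close>.\<close>

definition scale_integral :: "(real \<Rightarrow> real) \<Rightarrow> (real \<Rightarrow> real) \<Rightarrow> real \<Rightarrow> ennreal" where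
  "scale_integral s \<theta> x =
     (\<integral>\<^sup>+ z\<in>{0<..x}. ennreal (1 / (s z - s (z - \<theta> z))) \<partial>interval_measure s)"

definition exp_neg :: "ennreal \<Rightarrow> real" where
  "exp_neg I = (if I = \<infinity> then 0 else exp (- enn2real I))"

end

theory Submission
  imports Defs
begin

text \<open>In the natural scale \<open>B = s(Y)\<close>, with running supremum \<open>S\<close>, the event \<open>sup Y > x\<close> at \<open>T\<close> says
  up to null sets that \<open>S - B\<close> stays below a gap \<open>g(S)\<close> at all levels below \<open>s x\<close>, and
  \<open>ds(z) / (s(z) - s(z - \<theta>(z)))\<close> becomes \<open>db / g(b)\<close>. For levels \<open>a\<^sub>i\<close> and barriers \<open>l\<^sub>i < a\<^sub>i\<close>, stop
  \<open>B\<close> as soon as it hits \<open>l\<^sub>i\<close> between the passage times of \<open>a\<^sub>i\<close> and \<open>a\<^bsub>i+1\<^esub>\<close>, or reaches the last level: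
  the stopped process is bounded, so optional stopping for every number of levels gives the
  survival probability \<open>\<Prod> (a\<^sub>i - l\<^sub>i) / (a\<^bsub>i+1\<^esub> - l\<^sub>i)\<close>. Refining the levels yields
  \<open>exp (- \<integral> db / g(b))\<close> for continuous \<open>g\<close>. A Borel gap bounded below is close to a continuous one outside
  a set of levels of small measure, and a drawdown of depth \<open>c\<close> at a level in \<open>E\<close> has probability at
  most \<open>|E| / c\<close>; truncation of \<open>g\<close> covers the general case.\<close>

section \<open>Running suprema of continuous paths\<close>

text \<open>Only ladders with constant barriers are stopped; there the first end is attained and the
  stopped value is one of finitely many numbers. All other gaps are reached by inclusions between
  events. The product over the stages does not come from conditioning at passage times: subtracting
  the zero-expectation identities for \<open>i\<close> and \<open>i + 1\<close> stages isolates
  stage \<open>i\<close>. Not attaining \<open>T\<close> has a price at the very end: absence of a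
  drawdown below level x only gives a supremum at \<open>T\<close> of at least x, whereas the law
  concerns a strict inequality, so levels slightly above x must be used and then sent down to
  x.\<close>

context
  fixes B :: "real \<Rightarrow> 'a \<Rightarrow> real" and \<omega> :: 'a
  assumes cont: "continuous_on {0..} (\<lambda>t. B t \<omega>)"
begin

lemma running_sup_attained:
  assumes "0 \<le> t"
  obtains v where "0 \<le> v" "v \<le> t" "B v \<omega> = running_sup B t \<omega>"
proof -
  have "\<exists>v\<in>{0..t}. \<forall>u\<in>{0..t}. B u \<omega> \<le> B v \<omega>"
    using assms by (intro continuous_attains_sup continuous_on_subset[OF cont]) auto
  then obtain v where v: "v \<in> {0..t}" "\<And>u. u \<in> {0..t} \<Longrightarrow> B u \<omega> \<le> B v \<omega>" by blast
  then have "running_sup B t \<omega> = B v \<omega>"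
    unfolding running_sup_def by (intro cSup_eq_maximum) auto
  with v that show ?thesis by auto
qed

lemma le_running_sup:
  assumes "0 \<le> u" "u \<le> t"
  shows "B u \<omega> \<le> running_sup B t \<omega>"
  unfolding running_sup_def
proof (rule cSUP_upper)
  have "bounded ((\<lambda>t. B t \<omega>) ` {0..t})"
    by (intro compact_imp_bounded compact_continuous_image continuous_on_subset[OF cont]) auto
  then show "bdd_above ((\<lambda>u. B u \<omega>) ` {0..t})" by (rule bounded_imp_bdd_above)
qed (use assms in auto)

lemma running_sup_le_iff:
  assumes "0 \<le> t"
  shows "running_sup B t \<omega> \<le> x \<longleftrightarrow> (\<forall>u. 0 \<le> u \<longrightarrow> u \<le> t \<longrightarrow> B u \<omega> \<le> x)"
  using running_sup_attained[OF assms] le_running_sup by (metis order_trans)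

lemma running_sup_mono:
  assumes "0 \<le> u" "u \<le> t"
  shows "running_sup B u \<omega> \<le> running_sup B t \<omega>"
  using assms le_running_sup by (subst running_sup_le_iff) auto

lemma running_sup_continuous: "continuous_on {0..} (\<lambda>t. running_sup B t \<omega>)"
  unfolding continuous_on_iff
proof (intro ballI allI impI)
  fix t e :: real assume t: "t \<in> {0..}" and e: "0 < e"
  obtain d where d: "0 < d" "\<And>u. 0 \<le> u \<Longrightarrow> \<bar>u - t\<bar> < d \<Longrightarrow> \<bar>B u \<omega> - B t \<omega>\<bar> < e/4"
    using cont t e unfolding continuous_on_iff dist_real_def
    by (metis atLeast_iff divide_pos_pos zero_less_numeral)
  \<comment> \<open>On the window B oscillates by at most e/2, so new values on [u, v] exceed B at
    u, hence the old supremum, by at most e/2.\<close>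
  have *: "running_sup B v \<omega> \<le> running_sup B u \<omega> + e/2"
    if uv: "0 \<le> u" "u \<le> v" "\<bar>u - t\<bar> < d" "\<bar>v - t\<bar> < d" for u v
  proof (subst running_sup_le_iff, use uv in simp, intro allI impI)
    fix w assume w: "0 \<le> w" "w \<le> v"
    show "B w \<omega> \<le> running_sup B u \<omega> + e/2"
    proof (cases "w \<le> u")
      case True
      then show ?thesis using le_running_sup[OF w(1) True] e by simp
    next
      case False
      then have "\<bar>w - t\<bar> < d" using uv w by auto
      then have "\<bar>B w \<omega> - B t \<omega>\<bar> < e/4" "\<bar>B u \<omega> - B t \<omega>\<bar> < e/4" "B u \<omega> \<le> running_sup B u \<omega>"
        using d(2) w uv le_running_sup[of u u] by auto
      then show ?thesis by arith
    qed
  qed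
  show "\<exists>d>0. \<forall>u\<in>{0..}. dist u t < d \<longrightarrow> dist (running_sup B u \<omega>) (running_sup B t \<omega>) < e"
  proof (intro exI[of _ d] conjI ballI impI)
    fix u assume "u \<in> {0..}" "dist u t < d"
    then show "dist (running_sup B u \<omega>) (running_sup B t \<omega>) < e"
      using *[of u t] *[of t u] running_sup_mono[of u t] running_sup_mono[of t u] t d(1) e
      by (cases "u \<le> t") (auto simp: dist_real_def)
  qed (rule d(1))
qed

text \<open>The maximum over [0, t] is attained strictly before t, and by continuity the path stays
  below it for a while after t. This is what allows a drawdown time to be enclosed by rational
  times.\<close>

lemma running_sup_locally_constant:
  assumes t: "0 \<le> t" and less: "B t \<omega> < running_sup B t \<omega>"
  obtains d where "0 < d" "d \<le> t"
    "\<And>u. \<bar>u - t\<bar> \<le> d \<Longrightarrow> running_sup B u \<omega> = running_sup B t \<omega>"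
proof -
  obtain v where v: "0 \<le> v" "v \<le> t" "B v \<omega> = running_sup B t \<omega>"
    using running_sup_attained[OF t] .
  with less have "v < t" by (cases "v = t") auto
  obtain d where d: "0 < d" "\<And>u. 0 \<le> u \<Longrightarrow> \<bar>u - t\<bar> < d \<Longrightarrow> \<bar>B u \<omega> - B t \<omega>\<bar> < running_sup B t \<omega> - B t \<omega>"
    using cont t less unfolding continuous_on_iff dist_real_def
    by (metis atLeast_iff diff_gt_0_iff_gt)
  \<comment> \<open>The bound \<open>t - v\<close> keeps the window to the right of the maximiser v,
    the bound \<open>d/2\<close> keeps the path below the maximum.\<close>
  define e where "e = min (d/2) (t - v)"
  have e: "0 < e" "e < d" "e \<le> t - v" using d(1) \<open>v < t\<close> by (auto simp: e_def)
  show ?thesis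
  proof (rule that[of e])
    fix u assume u: "\<bar>u - t\<bar> \<le> e"
    then have "v \<le> u" using e by auto
    have "running_sup B u \<omega> \<le> running_sup B t \<omega>"
    proof (subst running_sup_le_iff, use \<open>v \<le> u\<close> v in simp, intro allI impI)
      fix w assume w: "0 \<le> w" "w \<le> u"
      show "B w \<omega> \<le> running_sup B t \<omega>"
      proof (cases "w \<le> t")
        case True
        then show ?thesis using le_running_sup w by simp
      next
        case False
        then have "\<bar>w - t\<bar> < d" using w u e by auto
        then show ?thesis using d(2)[of w] w by auto
      qed
    qed
    moreover have "running_sup B t \<omega> \<le> running_sup B u \<omega>"
      using le_running_sup[OF v(1) \<open>v \<le> u\<close>] v by simp
    ultimately show "running_sup B u \<omega> = running_sup B t \<omega>" by simp
  qed (use e v in auto)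
qed

lemma running_sup_level_attained:
  assumes "B 0 \<omega> \<le> y" "0 \<le> t" "y \<le> running_sup B t \<omega>"
  obtains u where "0 \<le> u" "u \<le> t" "B u \<omega> = y"
proof -
  obtain v where v: "0 \<le> v" "v \<le> t" "B v \<omega> = running_sup B t \<omega>"
    using running_sup_attained[OF assms(2)] .
  have "\<exists>u\<ge>0. u \<le> v \<and> B u \<omega> = y"
    using v assms by (intro IVT' continuous_on_subset[OF cont]) auto
  then show ?thesis using that v by auto
qed

end

lemma running_sup_compose:
  assumes cont: "continuous_on {0..} (\<lambda>t. Y t \<omega>)" and s: "mono s" "continuous_on UNIV (s :: real \<Rightarrow> real)"
    and t: "0 \<le> t"
  shows "running_sup (\<lambda>t \<omega>. s (Y t \<omega>)) t \<omega> = s (running_sup Y t \<omega>)"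
proof -
  obtain v where v: "0 \<le> v" "v \<le> t" "Y v \<omega> = running_sup Y t \<omega>"
    using running_sup_attained[where B=Y, OF cont t] .
  show ?thesis
    unfolding running_sup_def[of "\<lambda>t \<omega>. s (Y t \<omega>)"]
  proof (rule cSup_eq_maximum)
    show "s (running_sup Y t \<omega>) \<in> (\<lambda>u. s (Y u \<omega>)) ` {0..t}"
      using v by (auto intro!: image_eqI[where x=v])
    show "x \<le> s (running_sup Y t \<omega>)" if "x \<in> (\<lambda>u. s (Y u \<omega>)) ` {0..t}" for x
      using that le_running_sup[where B=Y, OF cont] s(1) by (auto simp: mono_def)
  qed
qed

section \<open>Measurability of drawdown events\<close>

text \<open>A violation at u < r persists at rational times just to the right of u; nothing lies to
  the right of r, so the endpoint, possibly irrational, is listed separately.\<close>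

lemma ball_le_dense:
  fixes f :: "real \<Rightarrow> real"
  assumes cont: "continuous_on {q..r} f" and le: "\<And>u. u \<in> \<rat> \<inter> {q..r} \<union> {q, r} \<Longrightarrow> f u \<le> y"
    and u: "u \<in> {q..r}"
  shows "f u \<le> y"
proof (rule ccontr)
  assume "\<not> f u \<le> y"
  with le[of r] u have "u < r" "y < f u" by (cases "u = r"; auto)+
  then obtain d where d: "0 < d" "\<And>v. v \<in> {q..r} \<Longrightarrow> \<bar>v - u\<bar> < d \<Longrightarrow> \<bar>f v - f u\<bar> < f u - y"
    using cont u unfolding continuous_on_iff dist_real_def by (metis diff_gt_0_iff_gt)
  obtain v where v: "v \<in> \<rat>" "u < v" "v < min r (u + d)"
    using Rats_dense_in_real[of u "min r (u + d)"] \<open>u < r\<close> d(1) by auto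
  then have "\<bar>f v - f u\<bar> < f u - y" using u by (intro d) auto
  moreover have "f v \<le> y" using v u by (intro le) auto
  ultimately show False by auto
qed

text \<open>The minimiser on the compact interval may be irrational. Nearby dense times only come
  within a slack of the minimum, hence the quantifier over 1 / (k + 1).\<close>

lemma bex_le_dense:
  fixes f :: "real \<Rightarrow> real"
  assumes cont: "continuous_on {q..r} f" and qr: "q \<le> r"
  shows "(\<exists>u\<in>{q..r}. f u \<le> y) \<longleftrightarrow> (\<forall>k::nat. \<exists>u\<in>\<rat> \<inter> {q..r} \<union> {q, r}. f u < y + 1 / real (Suc k))"
proof (intro iffI allI)
  fix k :: nat
  assume "\<exists>u\<in>{q..r}. f u \<le> y"
  then obtain u where u: "u \<in> {q..r}" "f u \<le> y" by blast
  show "\<exists>u\<in>\<rat> \<inter> {q..r} \<union> {q, r}. f u < y + 1 / real (Suc k)"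
  proof (rule ccontr)
    assume "\<not> ?thesis"
    then have "- f u \<le> - (y + 1 / real (Suc k))"
      by (intro ball_le_dense[of q r "\<lambda>u. - f u", OF continuous_on_minus[OF cont] _ u(1)])
        (force simp: not_less)
    moreover have "0 < 1 / real (Suc k)" by simp
    ultimately show False using u(2) by linarith
  qed
next
  assume *: "\<forall>k::nat. \<exists>u\<in>\<rat> \<inter> {q..r} \<union> {q, r}. f u < y + 1 / real (Suc k)"
  obtain v where v: "v \<in> {q..r}" "\<And>u. u \<in> {q..r} \<Longrightarrow> f v \<le> f u"
    using continuous_attains_inf[OF compact_Icc _ cont] qr by auto
  have "f v \<le> y"
  proof (rule ccontr)
    assume "\<not> f v \<le> y"
    then obtain k :: nat where k: "1 / real (Suc k) < f v - y"
      using nat_approx_posE[of "f v - y"] by auto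
    obtain u where "u \<in> \<rat> \<inter> {q..r} \<union> {q, r}" "f u < y + 1 / real (Suc k)" using * by blast
    with k v(2)[of u] qr show False by auto
  qed
  with v show "\<exists>u\<in>{q..r}. f u \<le> y" by blast
qed

locale adapted_continuous_process = filtered_prob_space M F
  for M :: "'a measure" and F :: "real \<Rightarrow> 'a measure" +
  fixes B :: "real \<Rightarrow> 'a \<Rightarrow> real"
  assumes adapted: "adapted F B"
    and paths: "continuous_paths M B"
begin

lemma path: "\<omega> \<in> space M \<Longrightarrow> continuous_on {0..} (\<lambda>t. B t \<omega>)"
  using paths by (auto simp: continuous_paths_def)

lemma measurable_F_mono:
  assumes "X \<in> borel_measurable (F u)" "u \<le> t"
  shows "X \<in> borel_measurable (F t)"
  using assms sets_F_mono[of u t] by (auto simp: measurable_def space_F)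

lemma measurable_F_M: "X \<in> borel_measurable (F t) \<Longrightarrow> X \<in> borel_measurable M"
  using sets_F_subset[of t] by (auto simp: measurable_def space_F)

lemma measurable_B_F: "0 \<le> u \<Longrightarrow> u \<le> t \<Longrightarrow> B u \<in> borel_measurable (F t)"
  using adapted measurable_F_mono by (auto simp: adapted_def)

lemma measurable_B: "0 \<le> t \<Longrightarrow> B t \<in> borel_measurable M"
  using measurable_B_F measurable_F_M by blast

lemma measurable_running_sup:
  assumes u: "0 \<le> u" "u \<le> t"
  shows "running_sup B u \<in> borel_measurable (F t)"
proof (rule borel_measurableI_le)
  fix y
  let ?Q = "\<rat> \<inter> {0..u} \<union> {0, u}"
  have "running_sup B u \<omega> \<le> y \<longleftrightarrow> (\<forall>v\<in>?Q. B v \<omega> \<le> y)" if \<omega>: "\<omega> \<in> space M" for \<omega>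
  proof
    assume le: "\<forall>v\<in>?Q. B v \<omega> \<le> y"
    have "B v \<omega> \<le> y" if "0 \<le> v" "v \<le> u" for v
      proof (rule ball_le_dense[of 0 u "\<lambda>v. B v \<omega>"])
      show "continuous_on {0..u} (\<lambda>v. B v \<omega>)" by (rule continuous_on_subset[OF path[OF \<omega>]]) auto
    qed (use le that in blast, use that in simp)
    then show "running_sup B u \<omega> \<le> y"
      using running_sup_le_iff[where B=B, OF path[OF \<omega>] u(1), of y] by auto
  qed (use running_sup_le_iff[where B=B, OF path[OF \<omega>] u(1), of y] u in auto)
  then have "{\<omega> \<in> space (F t). running_sup B u \<omega> \<le> y} = {\<omega> \<in> space (F t). \<forall>v\<in>?Q. B v \<omega> \<le> y}"
    by (auto simp: space_F)
  also have "\<dots> \<in> sets (F t)"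
  proof (intro sets.sets_Collect_countable_All')
    show "countable ?Q" by (auto simp: countable_rat)
    show "{\<omega> \<in> space (F t). B v \<omega> \<le> y} \<in> sets (F t)" if "v \<in> ?Q" for v
      by (intro borel_measurable_le borel_measurable_const measurable_B_F) (use that u in auto)
  qed
  finally show "{\<omega> \<in> space (F t). running_sup B u \<omega> \<le> y} \<in> sets (F t)" .
qed

text \<open>A time at which \<open>B\<close> is strictly below its running supremum has rational times \<open>q \<le> r\<close> around
  it with the same running supremum; this avoids projecting a Borel set in time.\<close>

lemma sets_drawdown_before:
  assumes L[measurable]: "L \<in> borel_measurable borel" and E[measurable]: "E \<in> sets borel"
    and less: "\<And>y. y \<in> E \<Longrightarrow> L y < y" and t: "0 \<le> t"
  shows "{\<omega>\<in>space M. \<exists>u. 0 \<le> u \<and> u \<le> t \<and> running_sup B u \<omega> \<in> E \<and> B u \<omega> \<le> L (running_sup B u \<omega>)} \<in> sets (F t)"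
proof -
  let ?S = "running_sup B"
  \<comment> \<open>The horizon t belongs to Q because for u = t the right end r of the enclosing
    interval has to be t itself.\<close>
  define Q where "Q = \<rat> \<inter> {0..t} \<union> {0, t}"
  let ?R = "\<lambda>q r. \<rat> \<inter> {q..r} \<union> {q, r}"
  define P where "P q r \<omega> \<longleftrightarrow> ?S q \<omega> = ?S r \<omega> \<and> ?S q \<omega> \<in> E \<and>
      (\<forall>k::nat. \<exists>v\<in>?R q r. B v \<omega> < L (?S q \<omega>) + 1 / real (Suc k))" for q r \<omega>
  have eq: "(\<exists>u. 0 \<le> u \<and> u \<le> t \<and> ?S u \<omega> \<in> E \<and> B u \<omega> \<le> L (?S u \<omega>)) \<longleftrightarrow>
      (\<exists>q\<in>Q. \<exists>r\<in>{r\<in>Q. q \<le> r}. P q r \<omega>)" if \<omega>: "\<omega> \<in> space M" for \<omega>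
  proof
    assume "\<exists>u. 0 \<le> u \<and> u \<le> t \<and> ?S u \<omega> \<in> E \<and> B u \<omega> \<le> L (?S u \<omega>)"
    then obtain u where u: "0 \<le> u" "u \<le> t" "?S u \<omega> \<in> E" "B u \<omega> \<le> L (?S u \<omega>)" by blast
    then obtain d where d: "0 < d" "d \<le> u" "\<And>v. \<bar>v - u\<bar> \<le> d \<Longrightarrow> ?S v \<omega> = ?S u \<omega>"
      using running_sup_locally_constant[where B=B, OF path[OF \<omega>] u(1)] less[OF u(3)]
      by (metis order_le_less_trans)
    obtain q where q: "q \<in> \<rat>" "u - d < q" "q < u" using Rats_dense_in_real[of "u - d" u] d(1) by auto
    obtain r where r: "r \<in> Q" "u \<le> r" "r \<le> u + d"
    proof (cases "u = t")
      case False
      then show ?thesis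
        using Rats_dense_in_real[of u "min t (u + d)"] d(1) u that unfolding Q_def
        by (metis (no_types, lifting) IntI UnI1 atLeastAtMost_iff dual_order.trans less_add_same_cancel1 linorder_not_le min_less_iff_conj nless_le order_less_imp_le)
    qed (use that[of t] d(1) in \<open>auto simp: Q_def\<close>)
    have S: "?S q \<omega> = ?S u \<omega>" "?S r \<omega> = ?S u \<omega>" using d(3)[of q] d(3)[of r] q r by auto
    have c: "continuous_on {q..r} (\<lambda>t. B t \<omega>)"
      using path[OF \<omega>] by (rule continuous_on_subset) (use q d(1,2) in auto)
    have "\<exists>v\<in>{q..r}. B v \<omega> \<le> L (?S q \<omega>)"
      using q r u S by (intro bexI[of _ u]) auto
    then have near: "\<forall>k::nat. \<exists>v\<in>?R q r. B v \<omega> < L (?S q \<omega>) + 1 / real (Suc k)"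
      unfolding bex_le_dense[OF c order_trans[OF less_imp_le[OF q(3)] r(2)]] .
    have "?S q \<omega> = ?S r \<omega>" "?S q \<omega> \<in> E" using S u(3) by simp_all
    with near have "P q r \<omega>" unfolding P_def by blast
    moreover have "q \<in> Q" "q \<le> r" using q r d(1,2) u by (auto simp: Q_def)
    ultimately show "\<exists>q\<in>Q. \<exists>r\<in>{r\<in>Q. q \<le> r}. P q r \<omega>" using r(1) by blast
  next
    assume "\<exists>q\<in>Q. \<exists>r\<in>{r\<in>Q. q \<le> r}. P q r \<omega>"
    then obtain q r where qr: "q \<in> Q" "r \<in> Q" "q \<le> r" "P q r \<omega>" by blast
    have S: "?S q \<omega> = ?S r \<omega>" "?S q \<omega> \<in> E" using qr(4) unfolding P_def by blast+
    have b: "0 \<le> q" "r \<le> t" using qr(1,2) t by (auto simp: Q_def)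
    have c: "continuous_on {q..r} (\<lambda>t. B t \<omega>)"
      using path[OF \<omega>] by (rule continuous_on_subset) (use b in auto)
    have "\<exists>v\<in>{q..r}. B v \<omega> \<le> L (?S q \<omega>)"
      unfolding bex_le_dense[OF c qr(3)] using qr(4) unfolding P_def by blast
    then obtain v where v: "v \<in> {q..r}" "B v \<omega> \<le> L (?S q \<omega>)" by blast
    \<comment> \<open>The supremum is monotone in time and agrees at q and r, so it is constant in
      between and the threshold taken at q is the right one at v.\<close>
    have "?S v \<omega> = ?S q \<omega>"
      using running_sup_mono[where B=B, OF path[OF \<omega>], of q v] running_sup_mono[where B=B, OF path[OF \<omega>], of v r] v(1) b S
      by auto
    then show "\<exists>u. 0 \<le> u \<and> u \<le> t \<and> ?S u \<omega> \<in> E \<and> B u \<omega> \<le> L (?S u \<omega>)"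
      using v b S by (intro exI[of _ v]) auto
  qed
  have "{\<omega>\<in>space (F t). \<exists>q\<in>Q. \<exists>r\<in>{r\<in>Q. q \<le> r}. P q r \<omega>} \<in> sets (F t)"
  proof (intro sets.sets_Collect_countable_Ex')
    show "countable Q" by (auto simp: Q_def countable_rat)
    then show "countable {r\<in>Q. q \<le> r}" for q by (rule countable_subset[rotated]) auto
    fix q r assume qr: "q \<in> Q" "r \<in> {r\<in>Q. q \<le> r}"
    then have [measurable]: "?S q \<in> borel_measurable (F t)" "?S r \<in> borel_measurable (F t)"
      using t by (auto simp: Q_def intro!: measurable_running_sup)
    have "{\<omega>\<in>space (F t). \<exists>v\<in>?R q r. B v \<omega> < L (?S q \<omega>) + 1 / real (Suc k)} \<in> sets (F t)" for k
    proof (intro sets.sets_Collect_countable_Ex')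
      show "countable (?R q r)" by (auto simp: countable_rat)
      fix v assume "v \<in> ?R q r"
      then have [measurable]: "B v \<in> borel_measurable (F t)"
        using qr t by (auto simp: Q_def intro!: measurable_B_F)
      show "{\<omega>\<in>space (F t). B v \<omega> < L (?S q \<omega>) + 1 / real (Suc k)} \<in> sets (F t)" by measurable
    qed
    then have "{\<omega>\<in>space (F t). \<forall>k::nat. \<exists>v\<in>?R q r. B v \<omega> < L (?S q \<omega>) + 1 / real (Suc k)} \<in> sets (F t)"
      by (rule sets.sets_Collect_countable_All)
    moreover have "{\<omega>\<in>space (F t). ?S q \<omega> = ?S r \<omega>} \<in> sets (F t)" "{\<omega>\<in>space (F t). ?S q \<omega> \<in> E} \<in> sets (F t)"
      by measurable
    ultimately show "{\<omega>\<in>space (F t). P q r \<omega>} \<in> sets (F t)"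
      unfolding P_def by (intro sets.sets_Collect_conj)
  qed
  then show ?thesis using eq by (simp add: space_F cong: conj_cong)
qed

lemma sets_drawdown:
  assumes "L \<in> borel_measurable borel" and "E \<in> sets borel" and "\<And>y. y \<in> E \<Longrightarrow> L y < y"
  shows "{\<omega>\<in>space M. \<exists>u\<ge>0. running_sup B u \<omega> \<in> E \<and> B u \<omega> \<le> L (running_sup B u \<omega>)} \<in> sets M"
proof -
  have "{\<omega>\<in>space M. \<exists>u\<ge>0. running_sup B u \<omega> \<in> E \<and> B u \<omega> \<le> L (running_sup B u \<omega>)} =
    (\<Union>n::nat. {\<omega>\<in>space M. \<exists>u. 0 \<le> u \<and> u \<le> real n \<and> running_sup B u \<omega> \<in> E \<and> B u \<omega> \<le> L (running_sup B u \<omega>)})"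
    (is "?l = ?r")
  proof (intro equalityI subsetI)
    fix \<omega> assume "\<omega> \<in> ?l"
    then obtain u where "\<omega> \<in> space M" "0 \<le> u" "running_sup B u \<omega> \<in> E" "B u \<omega> \<le> L (running_sup B u \<omega>)" by blast
    moreover obtain n :: nat where "u \<le> real n" using real_arch_simple by blast
    ultimately show "\<omega> \<in> ?r" by blast
  qed auto
  also have "\<dots> \<in> sets M"
  proof (intro sets.countable_UN image_subsetI)
    fix n :: nat
    show "{\<omega>\<in>space M. \<exists>u. 0 \<le> u \<and> u \<le> real n \<and> running_sup B u \<omega> \<in> E \<and> B u \<omega> \<le> L (running_sup B u \<omega>)} \<in> sets M"
      using sets_drawdown_before[OF assms of_nat_0_le_iff, of n] sets_F_subset[of "real n"] by blast
  qed
  finally show ?thesis .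
qed

end

section \<open>Optional stopping\<close>

text \<open>Times are rounded up to the grid of mesh K/m, never down: whether a stopping time rounds
  to the k-th grid point is then known at that grid point.\<close>

lemma grid_approximation:
  fixes K :: real
  assumes K: "0 < K"
  defines "\<kappa> \<equiv> \<lambda>m r. nat \<lceil>r * real m / K\<rceil>"
  shows "r \<in> {0..K} \<Longrightarrow> \<kappa> m r \<le> m"
    and "0 < m \<Longrightarrow> r \<in> {0..K} \<Longrightarrow> r \<le> K * \<kappa> m r / m \<and> K * \<kappa> m r / m \<le> r + K / m"
    and "0 < m \<Longrightarrow> r \<in> {0..K} \<Longrightarrow> \<kappa> m r = k \<longleftrightarrow> K * (real k - 1) / m < r \<and> r \<le> K * k / m"
    and "r \<in> {0..K} \<Longrightarrow> (\<lambda>m. K * \<kappa> m r / m) \<longlonglongrightarrow> r"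
proof -
  show le_m: "\<kappa> m r \<le> m" if "r \<in> {0..K}" for m r
  proof -
    have "r * real m / K \<le> real m" using that K by (simp add: pos_divide_le_eq mult.commute[of _ K] mult_right_mono)
    then have "\<lceil>r * real m / K\<rceil> \<le> int m" by (simp add: ceiling_le_iff)
    then show ?thesis unfolding \<kappa>_def by linarith
  qed
  have real_\<kappa>: "real (\<kappa> m r) = of_int \<lceil>r * real m / K\<rceil>" if "r \<in> {0..K}" for m r
    using that K by (auto simp: \<kappa>_def)
  show bnd: "r \<le> K * \<kappa> m r / m \<and> K * \<kappa> m r / m \<le> r + K / m" if "0 < m" "r \<in> {0..K}" for m r
  proof -
    have "r * m / K \<le> \<kappa> m r" "\<kappa> m r \<le> r * m / K + 1"
      unfolding real_\<kappa>[OF that(2)] using of_int_ceiling_le_add_one by auto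
    then show ?thesis using that(1) K by (auto simp: field_simps)
  qed
  show "\<kappa> m r = k \<longleftrightarrow> K * (real k - 1) / m < r \<and> r \<le> K * k / m"
    if m: "0 < m" and r: "r \<in> {0..K}" for m r k
  proof -
    have "0 \<le> r * real m / K" using r K by simp
    then have "0 \<le> \<lceil>r * real m / K\<rceil>" unfolding zero_le_ceiling by linarith
    then have "\<kappa> m r = k \<longleftrightarrow> \<lceil>r * real m / K\<rceil> = int k" by (auto simp: \<kappa>_def)
    also have "\<dots> \<longleftrightarrow> real k - 1 < r * m / K \<and> r * m / K \<le> k" by (auto simp: ceiling_eq_iff)
    also have "\<dots> \<longleftrightarrow> K * (real k - 1) / m < r \<and> r \<le> K * k / m"
      using m K by (simp add: field_simps)
    finally show ?thesis .
  qed
  show "(\<lambda>m. K * \<kappa> m r / m) \<longlonglongrightarrow> r" if "r \<in> {0..K}" for r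
  proof (rule real_tendsto_sandwich)
    show "\<forall>\<^sub>F m in sequentially. r \<le> K * \<kappa> m r / m" "\<forall>\<^sub>F m in sequentially. K * \<kappa> m r / m \<le> r + K / real m"
      by (rule eventually_mono[OF eventually_gt_at_top[of 0]]; use bnd[OF _ that] in blast)+
    show "(\<lambda>m. r + K / real m) \<longlonglongrightarrow> r"
      using tendsto_add[OF tendsto_const lim_const_over_n[of K], of r] by simp
  qed simp
qed

lemma (in prob_space) martingale_set_integral:
  assumes "martingale M F X" "subalgebra M (F u)" "0 \<le> u" "u \<le> t" "A \<in> sets (F u)"
  shows "(\<integral>\<omega>. indicator A \<omega> * X u \<omega> \<partial>M) = (\<integral>\<omega>. indicator A \<omega> * X t \<omega> \<partial>M)"
proof -
  interpret finite_measure_subalgebra M "F u"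
    by unfold_locales (rule assms(2))
  have A[measurable]: "A \<in> sets M" using assms(2,5) by (auto simp: subalgebra_def)
  have i: "integrable M (X t)" "integrable M (X u)" using assms by (auto simp: martingale_def)
  have ae: "AE \<omega> in M. real_cond_exp M (F u) (X t) \<omega> = X u \<omega>"
    using assms by (auto simp: martingale_def)
  have "(\<integral>\<omega>. indicator A \<omega> * X t \<omega> \<partial>M) = (\<integral>\<omega>. indicator A \<omega> * real_cond_exp M (F u) (X t) \<omega> \<partial>M)"
    using real_cond_exp_intA[OF i(1) assms(5)] by (simp add: set_lebesgue_integral_def)
  also have "\<dots> = (\<integral>\<omega>. indicator A \<omega> * X u \<omega> \<partial>M)"
    using ae i(2)
    by (intro integral_cong_AE) (auto elim!: eventually_mono)
  finally show ?thesis by simp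
qed

text \<open>The overshoot of the grid approximation is controlled through
  \<open>E[X\<^sub>\<sigma>; |X\<^sub>\<sigma>| \<le> C + 1] = E[X\<^sub>K; |X\<^sub>\<sigma>| \<le> C + 1]\<close>, valid for grid-valued \<open>\<sigma>\<close>.\<close>

lemma (in filtered_prob_space) optional_stopping:
  assumes X: "martingale M F X" and cont: "continuous_paths M X"
    and \<rho>: "stopping_time F \<rho>" "\<And>\<omega>. \<omega> \<in> space M \<Longrightarrow> \<rho> \<omega> \<in> {0..K}" and K: "0 < K"
    and bdd: "\<And>\<omega>. \<omega> \<in> space M \<Longrightarrow> \<bar>X (\<rho> \<omega>) \<omega>\<bar> \<le> C"
  shows "(\<lambda>\<omega>. X (\<rho> \<omega>) \<omega>) \<in> borel_measurable M"
    and "(\<integral>\<omega>. X (\<rho> \<omega>) \<omega> \<partial>M) = (\<integral>\<omega>. X K \<omega> \<partial>M)"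
proof -
  define \<kappa> where "\<kappa> m r = nat \<lceil>r * real m / K\<rceil>" for m r
  note grid = grid_approximation[OF K, folded \<kappa>_def]
  have sub: "subalgebra M (F t)" for t
    using sets_F_subset space_F by (auto simp: subalgebra_def)
  have C: "0 \<le> C" using bdd not_empty by fastforce
  have XF: "X t \<in> borel_measurable (F t)" and XM[measurable]: "integrable M (X t)" if "0 \<le> t" for t
    using X that by (auto simp: martingale_def adapted_def)
  \<comment> \<open>The truncation at C + 1 is decided at the grid time, so \<open>A m k\<close>
    lies in the sigma-algebra to which the martingale identity applies. It supplies a dominating
    constant without any uniform integrability.\<close>
  define A where "A m k = {\<omega>\<in>space M. \<kappa> m (\<rho> \<omega>) = k \<and> \<bar>X (K * k / m) \<omega>\<bar> \<le> C + 1}" for m k :: nat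
  have A: "A m k \<in> sets (F (K * k / m))" if "0 < m" for m k
  proof -
    let ?t = "K * k / m"
    have t: "0 \<le> ?t" "K * (real k - 1) / m \<le> ?t"
      using K that by (auto intro!: divide_right_mono mult_left_mono)
    have [measurable]: "X ?t \<in> borel_measurable (F ?t)" using XF t by auto
    have [measurable]: "Measurable.pred (F ?t) (\<lambda>\<omega>. \<rho> \<omega> \<le> ?t)" "Measurable.pred (F ?t) (\<lambda>\<omega>. \<rho> \<omega> \<le> K * (real k - 1) / m)"
      using stopping_time_le_const[OF \<rho>(1)] t by auto
    have "A m k = {\<omega>\<in>space (F ?t). (\<not> \<rho> \<omega> \<le> K * (real k - 1) / m \<and> \<rho> \<omega> \<le> ?t) \<and> \<bar>X ?t \<omega>\<bar> \<le> C + 1}"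
      unfolding A_def space_F by (intro Collect_cong conj_cong refl)
        (simp_all add: grid(3)[OF that \<rho>(2)] not_le)
    also have "\<dots> \<in> sets (F ?t)" by measurable
    finally show ?thesis .
  qed
  then have A_M[measurable]: "A m k \<in> sets M" if "0 < m" for m k
    using sets_F_subset that by blast
  have t_le: "0 \<le> K * k / m \<and> K * k / m \<le> K" if "k \<le> m" for k m :: nat
    using K that by (cases "m = 0") (auto simp: field_simps)
  define g where "g m \<omega> = (\<Sum>k\<le>m. indicator (A m k) \<omega> * X (K * k / m) \<omega>)" for m \<omega>
  define h where "h m \<omega> = (\<Sum>k\<le>m. indicator (A m k) \<omega> * X K \<omega>)" for m \<omega>
  \<comment> \<open>Only the term with k equal to the rounded index of
    \<open>\<rho> \<omega>\<close> survives in the sums.\<close>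
  have gh: "g m \<omega> = (if \<bar>X (K * \<kappa> m (\<rho> \<omega>) / m) \<omega>\<bar> \<le> C + 1 then X (K * \<kappa> m (\<rho> \<omega>) / m) \<omega> else 0)"
    "h m \<omega> = (if \<bar>X (K * \<kappa> m (\<rho> \<omega>) / m) \<omega>\<bar> \<le> C + 1 then X K \<omega> else 0)" if "\<omega> \<in> space M" for m \<omega>
  proof -
    have "(\<Sum>k\<le>m. indicator (A m k) \<omega> * x k) =
      (if \<bar>X (K * \<kappa> m (\<rho> \<omega>) / m) \<omega>\<bar> \<le> C + 1 then x (\<kappa> m (\<rho> \<omega>)) else 0)" for x :: "nat \<Rightarrow> real"
    proof -
      have "indicator (A m k) \<omega> * x k = (if k = \<kappa> m (\<rho> \<omega>) then
        (if \<bar>X (K * \<kappa> m (\<rho> \<omega>) / m) \<omega>\<bar> \<le> C + 1 then x k else 0) else 0)" for k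
        using that by (auto simp: A_def)
      then show ?thesis
        using grid(1)[OF \<rho>(2)[OF that]] by (simp only: sum.delta finite_atMost atMost_iff if_True)
    qed
    from this[of "\<lambda>k. X (K * k / m) \<omega>"] this[of "\<lambda>_. X K \<omega>"]
    show "g m \<omega> = (if \<bar>X (K * \<kappa> m (\<rho> \<omega>) / m) \<omega>\<bar> \<le> C + 1 then X (K * \<kappa> m (\<rho> \<omega>) / m) \<omega> else 0)"
      "h m \<omega> = (if \<bar>X (K * \<kappa> m (\<rho> \<omega>) / m) \<omega>\<bar> \<le> C + 1 then X K \<omega> else 0)"
      unfolding g_def h_def by auto
  qed
  have i_term: "integrable M (\<lambda>\<omega>. indicator (A m k) \<omega> * X t \<omega>)" if "0 \<le> t" "0 < m" for m k t
    using integrable_mult_indicator[OF A_M XM] that by auto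
  have int_eq: "integral\<^sup>L M (g m) = integral\<^sup>L M (h m)" if "0 < m" for m
  proof -
    have "integral\<^sup>L M (g m) = (\<Sum>k\<le>m. \<integral>\<omega>. indicator (A m k) \<omega> * X (K * k / m) \<omega> \<partial>M)"
      unfolding g_def using i_term that t_le by (intro Bochner_Integration.integral_sum) auto
    also have "\<dots> = (\<Sum>k\<le>m. \<integral>\<omega>. indicator (A m k) \<omega> * X K \<omega> \<partial>M)"
      using A that t_le by (intro sum.cong refl martingale_set_integral[OF X sub]) auto
    also have "\<dots> = integral\<^sup>L M (h m)"
      unfolding h_def using i_term that K by (intro Bochner_Integration.integral_sum[symmetric]) auto
    finally show ?thesis .
  qed
  have meas: "g (Suc m) \<in> borel_measurable M" "h (Suc m) \<in> borel_measurable M" for m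
    unfolding g_def h_def using K
    by (intro borel_measurable_sum borel_measurable_integrable i_term; use t_le[of _ "Suc m"] in simp)+
  have lim: "(\<lambda>m. X (K * \<kappa> m (\<rho> \<omega>) / m) \<omega>) \<longlonglongrightarrow> X (\<rho> \<omega>) \<omega>" if \<omega>: "\<omega> \<in> space M" for \<omega>
  proof (rule continuous_on_tendsto_compose[where s="{0..}" and f="\<lambda>t. X t \<omega>"])
    show "continuous_on {0..} (\<lambda>t. X t \<omega>)" using cont \<omega> by (auto simp: continuous_paths_def)
    show "(\<lambda>m. K * \<kappa> m (\<rho> \<omega>) / m) \<longlonglongrightarrow> \<rho> \<omega>" using grid(4)[OF \<rho>(2)[OF \<omega>]] .
  qed (use \<rho>(2)[OF \<omega>] K in auto)
  \<comment> \<open>The limit is bounded by C, strictly less than C + 1, so on each path the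
    truncation is eventually inactive.\<close>
  have ev: "\<forall>\<^sub>F m in sequentially. \<bar>X (K * \<kappa> m (\<rho> \<omega>) / m) \<omega>\<bar> \<le> C + 1" if \<omega>: "\<omega> \<in> space M" for \<omega>
    using order_tendstoD(2)[OF tendsto_rabs[OF lim[OF \<omega>]], of "C + 1"] bdd[OF \<omega>]
    by (auto elim!: eventually_mono)
  have lim_g: "(\<lambda>m. g (Suc m) \<omega>) \<longlonglongrightarrow> X (\<rho> \<omega>) \<omega>" if \<omega>: "\<omega> \<in> space M" for \<omega>
    by (rule LIMSEQ_Suc, rule Lim_transform_eventually[OF lim[OF \<omega>]])
       (use ev[OF \<omega>] in \<open>auto elim!: eventually_mono simp: gh[OF \<omega>]\<close>)
  have lim_h: "(\<lambda>m. h (Suc m) \<omega>) \<longlonglongrightarrow> X K \<omega>" if \<omega>: "\<omega> \<in> space M" for \<omega>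
    by (rule LIMSEQ_Suc, rule tendsto_eventually, rule eventually_mono[OF ev[OF \<omega>]]) (simp add: gh[OF \<omega>])
  show m: "(\<lambda>\<omega>. X (\<rho> \<omega>) \<omega>) \<in> borel_measurable M"
    by (rule borel_measurable_LIMSEQ_real[OF lim_g meas(1)])
  have "(\<lambda>m. integral\<^sup>L M (g (Suc m))) \<longlonglongrightarrow> (\<integral>\<omega>. X (\<rho> \<omega>) \<omega> \<partial>M)"
    by (rule integral_dominated_convergence[where w="\<lambda>_. C + 1"])
       (use m meas lim_g C in \<open>auto simp: gh\<close>)
  moreover have "(\<lambda>m. integral\<^sup>L M (h (Suc m))) \<longlonglongrightarrow> (\<integral>\<omega>. X K \<omega> \<partial>M)"
    by (rule integral_dominated_convergence[where w="\<lambda>\<omega>. \<bar>X K \<omega>\<bar>"])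
       (use m meas lim_h K XM[of K] in \<open>auto simp: gh\<close>)
  ultimately show "(\<integral>\<omega>. X (\<rho> \<omega>) \<omega> \<partial>M) = (\<integral>\<omega>. X K \<omega> \<partial>M)"
    using int_eq by (simp add: LIMSEQ_unique)
qed

text \<open>\<open>unbounded\<close> is the form in which recurrence enters: it makes the top of
  every finite ladder almost surely reachable.\<close>

locale unbounded_local_martingale = adapted_continuous_process M F B for M :: "'a measure" and F and B +
  assumes local_martingale: "continuous_local_martingale M F B"
    and start: "\<And>\<omega>. \<omega> \<in> space M \<Longrightarrow> B 0 \<omega> = 0"
    and unbounded: "\<And>y. AE \<omega> in M. \<exists>t\<ge>0. y \<le> B t \<omega>"
begin

text \<open>Stopping at \<open>\<tau> n\<close> gives true martingales that start at 0, so the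
  identity holds for each n. The value taken is B at the smaller of \<open>\<rho>\<close> and
  \<open>\<tau> n\<close>, which is why the bound is required on the whole path up to
  \<open>\<rho>\<close>; it dominates the passage n to infinity.\<close>

lemma stopped_expectation:
  assumes \<rho>: "stopping_time F \<rho>" "\<And>\<omega>. \<omega> \<in> space M \<Longrightarrow> \<rho> \<omega> \<in> {0..K}" and K: "0 < K"
    and bdd: "\<And>\<omega> u. \<omega> \<in> space M \<Longrightarrow> 0 \<le> u \<Longrightarrow> u \<le> \<rho> \<omega> \<Longrightarrow> \<bar>B u \<omega>\<bar> \<le> C"
  shows "(\<lambda>\<omega>. B (\<rho> \<omega>) \<omega>) \<in> borel_measurable M" and "(\<integral>\<omega>. B (\<rho> \<omega>) \<omega> \<partial>M) = 0"
proof -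
  obtain \<tau> :: "nat \<Rightarrow> 'a \<Rightarrow> real" where \<tau>: "\<And>n. stopping_time F (\<tau> n)" "\<And>n \<omega>. \<omega> \<in> space M \<Longrightarrow> 0 \<le> \<tau> n \<omega>"
    "AE \<omega> in M. filterlim (\<lambda>n. \<tau> n \<omega>) at_top sequentially"
    and X: "\<And>n. martingale M F (\<lambda>t \<omega>. B (min t (\<tau> n \<omega>)) \<omega> - B 0 \<omega>)"
    using local_martingale unfolding continuous_local_martingale_def by (auto elim: eventually_mono)
  define X where "X n t \<omega> = B (min t (\<tau> n \<omega>)) \<omega> - B 0 \<omega>" for n t \<omega>
  have Xm: "martingale M F (X n)" for n using X[of n] by (simp add: X_def[abs_def])
  have Xc: "continuous_paths M (X n)" for n
    unfolding continuous_paths_def X_def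
  proof
    fix \<omega> assume \<omega>: "\<omega> \<in> space M"
    show "continuous_on {0..} (\<lambda>t. B (min t (\<tau> n \<omega>)) \<omega> - B 0 \<omega>)"
      by (intro continuous_on_diff continuous_on_const continuous_on_compose2[OF path[OF \<omega>]] continuous_intros)
         (use \<tau>(2)[OF \<omega>] in auto)
  qed
  have Xb: "\<bar>X n (\<rho> \<omega>) \<omega>\<bar> \<le> C" if "\<omega> \<in> space M" for n \<omega>
    using bdd[OF that, of "min (\<rho> \<omega>) (\<tau> n \<omega>)"] \<rho>(2)[OF that] \<tau>(2)[OF that] start[OF that]
    by (auto simp: X_def)
  have meas: "(\<lambda>\<omega>. X n (\<rho> \<omega>) \<omega>) \<in> borel_measurable M" and int: "(\<integral>\<omega>. X n (\<rho> \<omega>) \<omega> \<partial>M) = (\<integral>\<omega>. X n K \<omega> \<partial>M)" for n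
    using optional_stopping[OF Xm Xc \<rho> K Xb] by auto
  have zero: "(\<integral>\<omega>. X n K \<omega> \<partial>M) = 0" for n
  proof -
    have sub: "subalgebra M (F t)" for t using sets_F_subset space_F by (auto simp: subalgebra_def)
    have "space M \<in> sets (F 0)" using sets.top[of "F 0"] by (simp add: space_F)
    then have "(\<integral>\<omega>. indicator (space M) \<omega> * X n 0 \<omega> \<partial>M) = (\<integral>\<omega>. indicator (space M) \<omega> * X n K \<omega> \<partial>M)"
      using martingale_set_integral[OF Xm sub, of 0 K] K by auto
    moreover have "(\<integral>\<omega>. indicator (space M) \<omega> * X n K \<omega> \<partial>M) = (\<integral>\<omega>. X n K \<omega> \<partial>M)"
      by (intro Bochner_Integration.integral_cong) auto
    moreover have "(\<integral>\<omega>. indicator (space M) \<omega> * X n 0 \<omega> \<partial>M) = (\<integral>\<omega>. 0 \<partial>M)"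
      by (intro Bochner_Integration.integral_cong) (auto simp: X_def \<tau>(2))
    ultimately show ?thesis by simp
  qed
  have C: "0 \<le> C" using Xb not_empty by fastforce
  \<comment> \<open>B at the random time \<open>\<rho>\<close> is a pointwise limit of B at
    grid-valued times, each of which is a countable gluing of measurable functions.\<close>
  obtain B' where B': "\<And>m::nat. B' m \<in> borel_measurable M" "\<And>\<omega>. \<omega> \<in> space M \<Longrightarrow> (\<lambda>m. B' m \<omega>) \<longlonglongrightarrow> B (\<rho> \<omega>) \<omega>"
  proof -
    define \<kappa> where "\<kappa> m r = nat \<lceil>r * real m / K\<rceil>" for m r
    note grid = grid_approximation[OF K, folded \<kappa>_def]
    have [measurable]: "\<rho> \<in> borel_measurable M"
      using \<rho>(1) sets_F_subset space_F by (rule measurable_stopping_time)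
    show ?thesis
    proof (rule that[of "\<lambda>m \<omega>. B (K * \<kappa> m (\<rho> \<omega>) / m) \<omega>"])
      fix m
      show "(\<lambda>\<omega>. B (K * \<kappa> m (\<rho> \<omega>) / m) \<omega>) \<in> borel_measurable M"
      proof (rule measurable_compose_countable[where f="\<lambda>k \<omega>. B (K * real k / m) \<omega>" and g="\<lambda>\<omega>. \<kappa> m (\<rho> \<omega>)"])
        show "(\<lambda>\<omega>. \<kappa> m (\<rho> \<omega>)) \<in> M \<rightarrow>\<^sub>M count_space UNIV" unfolding \<kappa>_def by measurable
        show "(\<lambda>\<omega>. B (K * real k / m) \<omega>) \<in> borel_measurable M" for k
          using K by (intro measurable_B) auto
      qed
    next
      fix \<omega> assume \<omega>: "\<omega> \<in> space M"
      show "(\<lambda>m. B (K * \<kappa> m (\<rho> \<omega>) / m) \<omega>) \<longlonglongrightarrow> B (\<rho> \<omega>) \<omega>"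
        by (rule continuous_on_tendsto_compose[where s="{0..}" and f="\<lambda>t. B t \<omega>", OF path[OF \<omega>] grid(4)])
           (use \<rho>(2)[OF \<omega>] K in auto)
    qed
  qed
  show m: "(\<lambda>\<omega>. B (\<rho> \<omega>) \<omega>) \<in> borel_measurable M"
    by (rule borel_measurable_LIMSEQ_real[OF B'(2) B'(1)])
  have "(\<lambda>n. \<integral>\<omega>. X n (\<rho> \<omega>) \<omega> \<partial>M) \<longlonglongrightarrow> (\<integral>\<omega>. B (\<rho> \<omega>) \<omega> \<partial>M)"
  proof (rule integral_dominated_convergence[where w="\<lambda>_. C"])
    show "AE \<omega> in M. (\<lambda>n. X n (\<rho> \<omega>) \<omega>) \<longlonglongrightarrow> B (\<rho> \<omega>) \<omega>"
      using \<tau>(3)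
    proof (rule AE_mp, intro AE_I2 impI)
      fix \<omega> assume \<omega>: "\<omega> \<in> space M" and "filterlim (\<lambda>n. \<tau> n \<omega>) at_top sequentially"
      \<comment> \<open>Once \<open>\<tau> n\<close> has passed \<open>\<rho>\<close>, localisation
        no longer changes the stopped value.\<close>
      then have "\<forall>\<^sub>F n in sequentially. \<rho> \<omega> \<le> \<tau> n \<omega>" by (simp add: filterlim_at_top)
      then have "\<forall>\<^sub>F n in sequentially. X n (\<rho> \<omega>) \<omega> = B (\<rho> \<omega>) \<omega>"
        by (auto elim!: eventually_mono simp: X_def start[OF \<omega>] min_def)
      then show "(\<lambda>n. X n (\<rho> \<omega>) \<omega>) \<longlonglongrightarrow> B (\<rho> \<omega>) \<omega>" by (rule tendsto_eventually)
    qed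
    show "AE \<omega> in M. norm (X n (\<rho> \<omega>) \<omega>) \<le> C" for n using Xb by auto
  qed (use m meas in auto)
  then show "(\<integral>\<omega>. B (\<rho> \<omega>) \<omega> \<partial>M) = 0"
    using LIMSEQ_unique[OF _ tendsto_const] by (simp add: int zero)
qed

end

section \<open>Gambling on a finite ladder of levels\<close>

locale level_ladder = unbounded_local_martingale M F B for M :: "'a measure" and F and B +
  fixes a l :: "nat \<Rightarrow> real"
  assumes a_0: "a 0 = 0" and a_less: "\<And>j. a j < a (Suc j)" and l_less: "\<And>j. l j < a j"
begin

text \<open>The current stage is read off the running supremum instead of passage times of levels.
  The half-open range makes the stage unique and stable immediately to the right of any
  time.\<close>

definition fails :: "nat \<Rightarrow> 'a \<Rightarrow> real \<Rightarrow> bool" where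
  "fails j \<omega> t \<longleftrightarrow> a j \<le> running_sup B t \<omega> \<and> running_sup B t \<omega> < a (Suc j) \<and> B t \<omega> \<le> l j"

definition failing :: "nat \<Rightarrow> 'a set" where
  "failing i = {\<omega>\<in>space M. \<exists>j<i. \<exists>t\<ge>0. fails j \<omega> t}"

definition ends :: "nat \<Rightarrow> 'a \<Rightarrow> real set" where
  "ends i \<omega> = {t. 0 \<le> t \<and> ((\<exists>j<i. fails j \<omega> t) \<or> a i \<le> running_sup B t \<omega>)}"

lemma a_strict_mono: "strict_mono a"
  using a_less by (simp add: strict_mono_Suc_iff)

lemma a_nonneg: "0 \<le> a i"
  using a_strict_mono a_0 by (metis strict_mono_less_eq zero_le)

lemma stage_exists:
  assumes "0 \<le> y" "y < a i"
  obtains j where "j < i" "a j \<le> y" "y < a (Suc j)"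
proof -
  have "\<exists>j<i. a j \<le> y \<and> y < a (Suc j)"
    using assms(2)
  proof (induction i)
    case (Suc i)
    then show ?case by (cases "y < a i") (auto simp: less_Suc_eq)
  qed (use assms(1) a_0 in auto)
  with that show ?thesis by blast
qed

lemma stage_unique:
  assumes "a j \<le> y" "y < a (Suc j)" "a k \<le> y" "y < a (Suc k)"
  shows "j = k"
proof -
  have "a j < a (Suc k)" "a k < a (Suc j)" using assms by auto
  then show ?thesis using strict_mono_less[OF a_strict_mono] by auto
qed

lemma sets_fails_before:
  assumes "0 \<le> t"
  shows "{\<omega>\<in>space M. \<exists>u. 0 \<le> u \<and> u \<le> t \<and> fails j \<omega> u} \<in> sets (F t)"
proof -
  have "{\<omega>\<in>space M. \<exists>u. 0 \<le> u \<and> u \<le> t \<and> running_sup B u \<omega> \<in> {a j..<a (Suc j)} \<and> B u \<omega> \<le> (\<lambda>_. l j) (running_sup B u \<omega>)} \<in> sets (F t)"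
    by (rule sets_drawdown_before) (use l_less[of j] assms in auto)
  then show ?thesis by (simp add: fails_def conj_assoc)
qed

lemma sets_failing [measurable]: "failing i \<in> sets M"
proof -
  have "{\<omega>\<in>space M. \<exists>u\<ge>0. running_sup B u \<omega> \<in> {a j..<a (Suc j)} \<and> B u \<omega> \<le> (\<lambda>_. l j) (running_sup B u \<omega>)} \<in> sets M" for j
    by (rule sets_drawdown) (use l_less[of j] in auto)
  then have "{\<omega>\<in>space M. \<exists>t\<ge>0. fails j \<omega> t} \<in> sets M" for j
    by (simp add: fails_def conj_assoc)
  then have "(\<Union>j<i. {\<omega>\<in>space M. \<exists>t\<ge>0. fails j \<omega> t}) \<in> sets M" by auto
  moreover have "failing i = (\<Union>j<i. {\<omega>\<in>space M. \<exists>t\<ge>0. fails j \<omega> t})"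
    by (auto simp: failing_def)
  ultimately show ?thesis by simp
qed

lemma failing_mono: "i \<le> j \<Longrightarrow> failing i \<subseteq> failing j"
  by (auto simp: failing_def intro: less_le_trans)

lemma running_sup_nonneg: "\<omega> \<in> space M \<Longrightarrow> 0 \<le> t \<Longrightarrow> 0 \<le> running_sup B t \<omega>"
  using le_running_sup[where B=B, OF path, of \<omega> 0 t] start by auto

text \<open>If the infimum r were not an end, then at r the path would lie strictly above the
  barrier of its stage and the supremum strictly below the next level. By continuity both persist
  just after r, where ends would have to accumulate.\<close>

lemma first_end:
  assumes \<omega>: "\<omega> \<in> space M" and ne: "ends i \<omega> \<noteq> {}"
  shows "Inf (ends i \<omega>) \<in> ends i \<omega>"
proof (rule ccontr)
  define r where "r = Inf (ends i \<omega>)"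
  assume "Inf (ends i \<omega>) \<notin> ends i \<omega>"
  then have notin: "r \<notin> ends i \<omega>" by (simp add: r_def)
  have bb: "bdd_below (ends i \<omega>)" by (rule bdd_belowI[of _ 0]) (auto simp: ends_def)
  have r0: "0 \<le> r" unfolding r_def by (rule cInf_greatest[OF ne]) (auto simp: ends_def)
  have near: "\<exists>t\<in>ends i \<omega>. r < t \<and> t < r + d" if d: "0 < d" for d
  proof -
    obtain t where t: "t \<in> ends i \<omega>" "t < r + d"
      using cInf_lessD[OF ne, of "r + d"] d by (auto simp: r_def)
    moreover have "r \<le> t" unfolding r_def by (rule cInf_lower[OF t(1) bb])
    moreover have "r \<noteq> t" using notin t(1) by auto
    ultimately show ?thesis by (intro bexI[of _ t]) auto
  qed
  have "running_sup B r \<omega> < a i" using notin r0 by (auto simp: ends_def)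
  then obtain j where j: "j < i" "a j \<le> running_sup B r \<omega>" "running_sup B r \<omega> < a (Suc j)"
    using stage_exists running_sup_nonneg[OF \<omega> r0] by blast
  have Br: "l j < B r \<omega>" using notin r0 j by (auto simp: ends_def fails_def)
  obtain d1 where d1: "0 < d1" "\<And>t. 0 \<le> t \<Longrightarrow> \<bar>t - r\<bar> < d1 \<Longrightarrow> \<bar>running_sup B t \<omega> - running_sup B r \<omega>\<bar> < a (Suc j) - running_sup B r \<omega>"
    using running_sup_continuous[where B=B, OF path[OF \<omega>]] r0 j(3) unfolding continuous_on_iff dist_real_def
    by (metis atLeast_iff diff_gt_0_iff_gt)
  obtain d2 where d2: "0 < d2" "\<And>t. 0 \<le> t \<Longrightarrow> \<bar>t - r\<bar> < d2 \<Longrightarrow> \<bar>B t \<omega> - B r \<omega>\<bar> < B r \<omega> - l j"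
    using path[OF \<omega>] r0 Br unfolding continuous_on_iff dist_real_def
    by (metis atLeast_iff diff_gt_0_iff_gt)
  obtain t where t: "t \<in> ends i \<omega>" "r < t" "t < r + min d1 d2" using near[of "min d1 d2"] d1(1) d2(1) by auto
  have S: "running_sup B t \<omega> < a (Suc j)" "l j < B t \<omega>" 
  proof -
    have "0 \<le> t" "\<bar>t - r\<bar> < d1" "\<bar>t - r\<bar> < d2" using t r0 by auto
    from d1(2)[OF this(1,2)] d2(2)[OF this(1,3)] show "running_sup B t \<omega> < a (Suc j)" "l j < B t \<omega>"
      by linarith+
  qed
  \<comment> \<open>With \<open>S\<close> this places time t in the same stage j as r, so an end at
    t could only be a failure of stage j.\<close>
  have S': "a j \<le> running_sup B t \<omega>"
    using running_sup_mono[where B=B, OF path[OF \<omega>] r0, of t] t j by auto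
  have "a (Suc j) \<le> a i" using j(1) strict_mono_less_eq[OF a_strict_mono] by auto
  then obtain k where "fails k \<omega> t" using t(1) S by (auto simp: ends_def)
  moreover from this have "k = j" using stage_unique[OF _ _ S' S(1)] by (auto simp: fails_def)
  ultimately show False using S(2) by (auto simp: fails_def)
qed

lemma first_end_le: "t \<in> ends i \<omega> \<Longrightarrow> Inf (ends i \<omega>) \<le> t"
  by (rule cInf_lower) (auto simp: ends_def intro!: bdd_belowI[of _ 0])

text \<open>After attaining its maximum the path must cross the barrier on its way down, and the
  supremum is constant meanwhile. The crossing is thus itself an end, and minimality of r identifies
  it with r.\<close>

lemma value_at_failure:
  assumes \<omega>: "\<omega> \<in> space M" and j: "fails j \<omega> r" "j < i" and r: "r = Inf (ends i \<omega>)" "0 \<le> r"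
  shows "B r \<omega> = l j"
proof -
  obtain v where v: "0 \<le> v" "v \<le> r" "B v \<omega> = running_sup B r \<omega>"
    using running_sup_attained[where B=B, OF path[OF \<omega>] r(2)] .
  have "\<exists>u\<ge>v. u \<le> r \<and> B u \<omega> = l j"
  proof (rule IVT2')
    show "continuous_on {v..r} (\<lambda>u. B u \<omega>)" by (rule continuous_on_subset[OF path[OF \<omega>]]) (use v in auto)
  qed (use v j l_less[of j] in \<open>auto simp: fails_def\<close>)
  then obtain u where u: "v \<le> u" "u \<le> r" "B u \<omega> = l j" by blast
  have "running_sup B u \<omega> = running_sup B r \<omega>"
    using le_running_sup[where B=B, OF path[OF \<omega>] v(1) u(1)] running_sup_mono[where B=B, OF path[OF \<omega>] _ u(2)] v u by auto
  then have "u \<in> ends i \<omega>" using u v j by (auto simp: ends_def fails_def)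
  then have "u = r" using first_end_le[of u i \<omega>] u(2) r(1) by simp
  then show ?thesis using u by simp
qed

lemma value_at_top:
  assumes \<omega>: "\<omega> \<in> space M" and top: "a i \<le> running_sup B r \<omega>" and r: "r = Inf (ends i \<omega>)" "0 \<le> r"
  shows "B r \<omega> = a i"
proof -
  obtain u where u: "0 \<le> u" "u \<le> r" "B u \<omega> = a i"
    using running_sup_level_attained[where B=B, OF path[OF \<omega>] _ r(2) top] start[OF \<omega>] a_nonneg by auto
  have "a i \<le> running_sup B u \<omega>" using le_running_sup[where B=B, OF path[OF \<omega>] u(1) order_refl] u by simp
  then have "u \<in> ends i \<omega>" using u by (auto simp: ends_def)
  then have "u = r" using first_end_le[of u i \<omega>] u(2) r(1) by simp
  then show ?thesis using u by simp
qed

text \<open>A crude majorant of the top level and of all barriers below it; the sum stands in for a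
  maximum.\<close>

definition bound :: "nat \<Rightarrow> real" where
  "bound i = a i + (\<Sum>j<i. \<bar>l j\<bar>)"

text \<open>Before the end the path lies between the barrier of its stage and the top level; at the
  end it equals a barrier or the top. The second hypothesis also covers paths without any
  end.\<close>

lemma bounded_before_end:
  assumes \<omega>: "\<omega> \<in> space M" and u: "0 \<le> u" "\<And>v. v \<in> ends i \<omega> \<Longrightarrow> u \<le> v"
  shows "\<bar>B u \<omega>\<bar> \<le> bound i"
proof -
  have lb: "\<bar>l j\<bar> \<le> bound i" if "j < i" for j
    using member_le_sum[of j "{..<i}" "\<lambda>j. \<bar>l j\<bar>"] that a_nonneg[of i] by (auto simp: bound_def)
  have ab: "a i \<le> bound i" by (auto simp: bound_def sum_nonneg)
  show ?thesis
  proof (cases "u \<in> ends i \<omega>")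
    case True
    have "u = Inf (ends i \<omega>)"
      by (rule sym, rule cInf_eq_minimum[OF True u(2)])
    moreover from True have "(\<exists>j<i. fails j \<omega> u) \<or> a i \<le> running_sup B u \<omega>" by (auto simp: ends_def)
    ultimately have "(\<exists>j<i. B u \<omega> = l j) \<or> B u \<omega> = a i"
      using value_at_failure[OF \<omega>] value_at_top[OF \<omega>] u(1) by metis
    then show ?thesis using lb ab a_nonneg[of i] by auto
  next
    case False
    then have S: "running_sup B u \<omega> < a i" using u(1) by (auto simp: ends_def)
    then obtain j where j: "j < i" "a j \<le> running_sup B u \<omega>" "running_sup B u \<omega> < a (Suc j)"
      using stage_exists running_sup_nonneg[OF \<omega> u(1)] by blast
    with False u(1) have "l j < B u \<omega>" by (auto simp: ends_def fails_def)
    moreover have "B u \<omega> \<le> running_sup B u \<omega>" by (rule le_running_sup[where B=B, OF path[OF \<omega>] u(1) order_refl])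
    ultimately show ?thesis using S lb[OF j(1)] ab by auto
  qed
qed

text \<open>The difference \<open>failing (Suc j) - failing j\<close> is the event that stage j is
  the first to fail, so this writes the value at the first end through events whose probabilities
  are wanted.\<close>

definition end_value :: "nat \<Rightarrow> 'a \<Rightarrow> real" where
  "end_value i \<omega> = a i * indicator (space M - failing i) \<omega>
     + (\<Sum>j<i. l j * indicator (failing (Suc j) - failing j) \<omega>)"

lemma end_value_eq:
  assumes \<omega>: "\<omega> \<in> space M" and ne: "ends i \<omega> \<noteq> {}"
  shows "B (Inf (ends i \<omega>)) \<omega> = end_value i \<omega>"
proof -
  define r where "r = Inf (ends i \<omega>)"
  have r: "r \<in> ends i \<omega>" using first_end[OF \<omega> ne] by (simp add: r_def)
  then have r0: "0 \<le> r" by (auto simp: ends_def)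
  show ?thesis
  proof (cases "\<omega> \<in> failing i")
    case False
    then have "\<omega> \<notin> failing (Suc j)" if "j < i" for j using failing_mono[of "Suc j" i] that by auto
    then have "(\<Sum>j<i. l j * indicator (failing (Suc j) - failing j) \<omega>) = 0"
      by (intro sum.neutral) (auto simp: indicator_def)
    moreover have "a i \<le> running_sup B r \<omega>" using r False \<omega> by (auto simp: ends_def failing_def)
    then have "B r \<omega> = a i" using value_at_top[OF \<omega> _ r_def r0] by simp
    ultimately show ?thesis using False \<omega> by (simp add: end_value_def r_def)
  next
    case True
    then obtain k t where k: "k < i" "0 \<le> t" "fails k \<omega> t" by (auto simp: failing_def)
    then have "t \<in> ends i \<omega>" by (auto simp: ends_def)
    then have "r \<le> t" using first_end_le by (simp add: r_def)
    \<comment> \<open>Some failure occurs no earlier than r, at a supremum below the top. Hence the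
      top is not yet reached at r, and the end at r is a failure.\<close>
    then have "running_sup B r \<omega> \<le> running_sup B t \<omega>" using running_sup_mono[where B=B, OF path[OF \<omega>] r0] by simp
    also have "\<dots> < a (Suc k)" using k by (simp add: fails_def)
    also have "\<dots> \<le> a i" using k(1) strict_mono_less_eq[OF a_strict_mono] by auto
    finally obtain j where j: "j < i" "fails j \<omega> r" using r by (auto simp: ends_def)
    have in_Suc: "\<omega> \<in> failing (Suc j)" using j r0 \<omega> by (auto simp: failing_def)
    have notin: "\<omega> \<notin> failing j"
    \<comment> \<open>A failure of an earlier stage would happen after r yet at a smaller supremum,
      against monotonicity.\<close>
    proof
      assume "\<omega> \<in> failing j"
      then obtain k t where k: "k < j" "0 \<le> t" "fails k \<omega> t" by (auto simp: failing_def)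
      moreover from k j have "k < i" by simp
      ultimately have "t \<in> ends i \<omega>" by (auto simp: ends_def)
      then have "r \<le> t" using first_end_le by (simp add: r_def)
      then have "running_sup B r \<omega> \<le> running_sup B t \<omega>" using running_sup_mono[where B=B, OF path[OF \<omega>] r0] by simp
      also have "\<dots> < a (Suc k)" using k by (simp add: fails_def)
      also have "\<dots> \<le> a j" using k(1) strict_mono_less_eq[OF a_strict_mono] by auto
      finally show False using j by (simp add: fails_def)
    qed
    have "l k * indicator (failing (Suc k) - failing k) \<omega> = (if k = j then l j else 0)" for k
    proof -
      have "\<omega> \<notin> failing (Suc k)" if "k < j" using failing_mono[of "Suc k" j] that notin by auto
      moreover have "\<omega> \<in> failing k" if "j < k" using failing_mono[of "Suc j" k] that in_Suc by auto
      ultimately show ?thesis using in_Suc notin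
        by (cases k j rule: linorder_cases) (auto simp: indicator_def)
    qed
    then have "(\<Sum>k<i. l k * indicator (failing (Suc k) - failing k) \<omega>) = l j"
      using j(1) by (simp only: sum.delta finite_lessThan lessThan_iff if_True)
    moreover have "B r \<omega> = l j" using value_at_failure[OF \<omega> j(2,1) r_def r0] .
    ultimately show ?thesis using True by (simp add: end_value_def r_def)
  qed
qed

text \<open>The first end is capped at K to make the stopping time bounded. As K grows the cap
  disappears on almost every path, because the top level is almost surely reached.\<close>

lemma expectation_end_value: "(\<integral>\<omega>. end_value i \<omega> \<partial>M) = 0"
proof -
  define \<rho> where "\<rho> K \<omega> = (if ends i \<omega> = {} then K else min (Inf (ends i \<omega>)) K)" for K \<omega>
  have \<rho>: "\<rho> K \<omega> \<in> {0..K}" if "0 < K" for K \<omega>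
  proof (cases "ends i \<omega> = {}")
    case False
    have "0 \<le> Inf (ends i \<omega>)" by (rule cInf_greatest[OF False]) (simp add: ends_def)
    then show ?thesis using that False by (simp add: \<rho>_def)
  qed (use that in \<open>simp add: \<rho>_def\<close>)
  have \<rho>_le: "\<rho> K \<omega> \<le> v" if "v \<in> ends i \<omega>" for K \<omega> v
  proof -
    have "ends i \<omega> \<noteq> {}" using that by blast
    then show ?thesis using first_end_le[OF that] by (simp add: \<rho>_def)
  qed
  have stop: "stopping_time F (\<rho> K)" if K: "0 < K" for K
  proof
    fix t
    consider "K \<le> t" | "t < 0" | "0 \<le> t" "t < K" by linarith
    then have "{\<omega>\<in>space M. \<rho> K \<omega> \<le> t} \<in> sets (F t)"
    proof cases
      case 1
      then have "\<rho> K \<omega> \<le> t" for \<omega> using \<rho>[OF K, of \<omega>] by simp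
      then have "{\<omega>\<in>space M. \<rho> K \<omega> \<le> t} = space (F t)" by (simp add: space_F)
      then show ?thesis by simp
    next
      case 2
      then have "\<not> \<rho> K \<omega> \<le> t" for \<omega> using \<rho>[OF K, of \<omega>] by simp
      then have "{\<omega>\<in>space M. \<rho> K \<omega> \<le> t} = {}" by simp
      then show ?thesis by (simp only: sets.empty_sets)
    next
      case 3
      \<comment> \<open>Here attainment of the infimum is essential: the event becomes the
        occurrence of an end by time t, which the filtration sees without right-continuity.\<close>
      have "{\<omega>\<in>space M. \<rho> K \<omega> \<le> t} = {\<omega>\<in>space M. \<exists>u\<in>ends i \<omega>. u \<le> t}"
      proof (intro Collect_cong conj_cong refl iffI)
        fix \<omega> assume \<omega>: "\<omega> \<in> space M" and le: "\<rho> K \<omega> \<le> t"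
        with 3 have "ends i \<omega> \<noteq> {}" by (auto simp: \<rho>_def)
        moreover from this le 3 have "Inf (ends i \<omega>) \<le> t" by (simp add: \<rho>_def)
        ultimately show "\<exists>u\<in>ends i \<omega>. u \<le> t" using first_end[OF \<omega>] by blast
      next
        fix \<omega> assume "\<exists>u\<in>ends i \<omega>. u \<le> t"
        then show "\<rho> K \<omega> \<le> t" using \<rho>_le order_trans by blast
      qed
      also have "\<dots> = (\<Union>j<i. {\<omega>\<in>space M. \<exists>u. 0 \<le> u \<and> u \<le> t \<and> fails j \<omega> u}) \<union> {\<omega>\<in>space (F t). a i \<le> running_sup B t \<omega>}"
      proof (intro set_eqI iffI)
        fix \<omega> assume "\<omega> \<in> {\<omega>\<in>space M. \<exists>u\<in>ends i \<omega>. u \<le> t}"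
        then obtain u where u: "\<omega> \<in> space M" "0 \<le> u" "u \<le> t" "(\<exists>j<i. fails j \<omega> u) \<or> a i \<le> running_sup B u \<omega>"
          by (auto simp: ends_def)
        moreover have "running_sup B u \<omega> \<le> running_sup B t \<omega>"
          using running_sup_mono[where B=B, OF path] u by auto
        ultimately show "\<omega> \<in> (\<Union>j<i. {\<omega>\<in>space M. \<exists>u. 0 \<le> u \<and> u \<le> t \<and> fails j \<omega> u}) \<union> {\<omega>\<in>space (F t). a i \<le> running_sup B t \<omega>}"
          by (auto simp: space_F intro: order_trans)
      qed (use 3(1) in \<open>auto simp: ends_def space_F\<close>)
      also have "\<dots> \<in> sets (F t)"
        using sets_fails_before[OF 3(1)] measurable_running_sup[OF 3(1) order_refl]
        by (intro sets.Un sets.finite_UN borel_measurable_le) auto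
      finally show ?thesis .
    qed
    then show "Measurable.pred (F t) (\<lambda>\<omega>. \<rho> K \<omega> \<le> t)" by (simp add: pred_def space_F)
  qed
  have bdd: "\<bar>B u \<omega>\<bar> \<le> bound i" if "\<omega> \<in> space M" "0 \<le> u" "u \<le> \<rho> K \<omega>" for K u \<omega>
    using bounded_before_end[OF that(1,2)] that(3) \<rho>_le order_trans by metis
  have stopped: "(\<lambda>\<omega>. B (\<rho> K \<omega>) \<omega>) \<in> borel_measurable M" "(\<integral>\<omega>. B (\<rho> K \<omega>) \<omega> \<partial>M) = 0" if "0 < K" for K
    using stopped_expectation[OF stop \<rho> that bdd] that by auto
  have "(\<lambda>n. \<integral>\<omega>. B (\<rho> (real (Suc n)) \<omega>) \<omega> \<partial>M) \<longlonglongrightarrow> (\<integral>\<omega>. end_value i \<omega> \<partial>M)"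
  proof (rule integral_dominated_convergence[where w="\<lambda>_. bound i"])
    show "end_value i \<in> borel_measurable M" unfolding end_value_def[abs_def] by measurable
    show "AE \<omega> in M. (\<lambda>n. B (\<rho> (real (Suc n)) \<omega>) \<omega>) \<longlonglongrightarrow> end_value i \<omega>"
      using unbounded[of "a i"]
    proof (rule AE_mp, intro AE_I2 impI)
      fix \<omega> assume \<omega>: "\<omega> \<in> space M" and "\<exists>t\<ge>0. a i \<le> B t \<omega>"
      then obtain t where "0 \<le> t" "a i \<le> B t \<omega>" by blast
      then have "t \<in> ends i \<omega>"
        using le_running_sup[where B=B, OF path[OF \<omega>], of t t] by (auto simp: ends_def)
      then have ne: "ends i \<omega> \<noteq> {}" by auto
      obtain N :: nat where N: "Inf (ends i \<omega>) \<le> real N" using real_arch_simple by blast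
      have "B (\<rho> (real (Suc n)) \<omega>) \<omega> = end_value i \<omega>" if "N \<le> n" for n
        using that N ne end_value_eq[OF \<omega> ne] by (simp add: \<rho>_def min_def)
      then show "(\<lambda>n. B (\<rho> (real (Suc n)) \<omega>) \<omega>) \<longlonglongrightarrow> end_value i \<omega>"
        by (intro tendsto_eventually eventually_sequentiallyI)
    qed
    show "AE \<omega> in M. norm (B (\<rho> (real (Suc n)) \<omega>) \<omega>) \<le> bound i" for n
    proof (rule AE_I2)
      fix \<omega> assume "\<omega> \<in> space M"
      then show "norm (B (\<rho> (real (Suc n)) \<omega>) \<omega>) \<le> bound i"
        using bdd[OF _ _ order_refl] \<rho>[of "real (Suc n)" \<omega>] by simp
    qed
  qed (use stopped in auto)
  then have "(\<lambda>n. 0) \<longlonglongrightarrow> (\<integral>\<omega>. end_value i \<omega> \<partial>M)" by (simp only: stopped(2) of_nat_0_less_iff zero_less_Suc)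
  then show ?thesis using LIMSEQ_unique tendsto_const by blast
qed

text \<open>In the difference of the identities for \<open>i\<close> and \<open>Suc i\<close> all
  contributions of the earlier stages cancel, leaving the ruin equation of stage i. This replaces
  conditioning at the passage of level \<open>a i\<close>.\<close>

lemma prob_not_failing_Suc:
  "prob (space M - failing (Suc i)) * (a (Suc i) - l i) = prob (space M - failing i) * (a i - l i)"
proof -
  define p where "p i = prob (space M - failing i)" for i
  have diff: "prob (failing (Suc j) - failing j) = p j - p (Suc j)" for j
    using failing_mono[of j "Suc j"] by (auto simp: p_def finite_measure_Diff prob_compl)
  have "(\<integral>\<omega>. end_value i \<omega> \<partial>M) = a i * p i + (\<Sum>j<i. l j * (p j - p (Suc j)))" for i
  proof -
    have ind: "integrable M (\<lambda>\<omega>. c * indicator A \<omega>)" if "A \<in> sets M" for c :: real and A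
      using that by (intro integrable_mult_right) (auto simp: integrable_indicator_iff less_top[symmetric])
    have "(\<integral>\<omega>. end_value i \<omega> \<partial>M) = (\<integral>\<omega>. a i * indicator (space M - failing i) \<omega> \<partial>M)
        + (\<integral>\<omega>. (\<Sum>j<i. l j * indicator (failing (Suc j) - failing j) \<omega>) \<partial>M)"
      unfolding end_value_def
      by (intro Bochner_Integration.integral_add Bochner_Integration.integrable_sum ind) auto
    also have "(\<integral>\<omega>. (\<Sum>j<i. l j * indicator (failing (Suc j) - failing j) \<omega>) \<partial>M)
        = (\<Sum>j<i. \<integral>\<omega>. l j * indicator (failing (Suc j) - failing j) \<omega> \<partial>M)"
      by (intro Bochner_Integration.integral_sum ind) auto
    finally show ?thesis by (simp add: p_def[of i] diff[symmetric])
  qed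
  then have "a i * p i + (\<Sum>j<i. l j * (p j - p (Suc j))) = 0" for i
    using expectation_end_value by metis
  from this[of i] this[of "Suc i"] have "a (Suc i) * p (Suc i) + l i * (p i - p (Suc i)) = a i * p i" by simp
  then show ?thesis by (simp add: p_def[symmetric] algebra_simps)
qed

lemma prob_not_failing: "prob (space M - failing n) = (\<Prod>i<n. (a i - l i) / (a (Suc i) - l i))"
proof (induction n)
  case 0
  then show ?case by (simp add: failing_def prob_space)
next
  case (Suc n)
  have "a (Suc n) - l n \<noteq> 0" using a_less[of n] l_less[of n] by simp
  then have "prob (space M - failing (Suc n)) = prob (space M - failing n) * ((a n - l n) / (a (Suc n) - l n))"
    using prob_not_failing_Suc[of n] by (simp add: field_simps)
  then show ?case using Suc by simp
qed

end

section \<open>Bounds for drawdown probabilities\<close>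

context unbounded_local_martingale
begin

definition drops :: "real set \<Rightarrow> (real \<Rightarrow> real) \<Rightarrow> 'a set" where
  "drops E g = {\<omega>\<in>space M. \<exists>t\<ge>0. running_sup B t \<omega> \<in> E \<and> g (running_sup B t \<omega>) \<le> running_sup B t \<omega> - B t \<omega>}"

lemma sets_drops:
  assumes [measurable]: "g \<in> borel_measurable borel" and "E \<in> sets borel" "\<And>y. y \<in> E \<Longrightarrow> 0 < g y"
  shows "drops E g \<in> sets M"
proof -
  have "{\<omega>\<in>space M. \<exists>t\<ge>0. running_sup B t \<omega> \<in> E \<and> B t \<omega> \<le> (\<lambda>y. y - g y) (running_sup B t \<omega>)} \<in> sets M"
    by (rule sets_drawdown) (use assms in auto)
  then show ?thesis by (simp add: drops_def algebra_simps)
qed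

lemma drops_mono:
  assumes "E \<subseteq> E'" "\<And>y. y \<in> E \<Longrightarrow> g' y \<le> g y"
  shows "drops E g \<subseteq> drops E' g'"
  using assms unfolding drops_def by (blast intro: order_trans)

lemma drops_UN: "drops (\<Union>i\<in>I. E i) g = (\<Union>i\<in>I. drops (E i) g)"
  by (auto simp: drops_def)

text \<open>A drawdown of depth c from a level in [x, y) ends below y - c, hence fails a stage [x,
  y) with barrier y - c. Gambler's ruin gives that failure probability (y - x) / c. The barrier lies
  below x only if y - x < c; otherwise the bound is at least 1.\<close>

lemma prob_drops_Ico:
  assumes xy: "0 \<le> x" "x \<le> y" and c: "0 < c"
  shows "prob (drops {x..<y} (\<lambda>_. c)) \<le> (y - x) / c"
proof -
  let ?D = "drops {x..<y} (\<lambda>_. c)"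
  have D[measurable]: "?D \<in> sets M" by (rule sets_drops) (use c in auto)
  consider "x = y" | "c \<le> y - x" | "x < y" "y - x < c" "x = 0" | "x < y" "y - x < c" "0 < x" using xy by linarith
  then show ?thesis
  proof cases
    case 1
    then show ?thesis by (simp add: drops_def)
  next
    case 2
    then have "1 \<le> (y - x) / c" using c by simp
    then show ?thesis using prob_le_1 order_trans by blast
  next
    case 3
    \<comment> \<open>Only stage 0, which is [0, y) with barrier y - c, is used; the other stages
      merely continue the ladder.\<close>
    interpret level_ladder M F B "\<lambda>j. y * j" "\<lambda>j. y * j - (c - y)"
      by unfold_locales (use 3 in \<open>auto simp: algebra_simps\<close>)
    have "?D \<subseteq> failing 1"
    proof
      fix \<omega> assume "\<omega> \<in> ?D"
      then obtain t where "\<omega> \<in> space M" "0 \<le> t" "running_sup B t \<omega> \<in> {x..<y}" "c \<le> running_sup B t \<omega> - B t \<omega>"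
        by (auto simp: drops_def)
      then show "\<omega> \<in> failing 1" using 3 by (auto simp: failing_def fails_def intro!: exI[of _ t])
    qed
    then have "prob ?D \<le> prob (failing 1)" by (intro finite_measure_mono) auto
    also have "\<dots> = 1 - (c - y) / c"
      using prob_not_failing[of 1] by (simp add: prob_compl)
    also have "\<dots> = (y - x) / c" using c 3 by (simp add: field_simps)
    finally show ?thesis .
  next
    case 4
    \<comment> \<open>A first stage \<open>[0, x)\<close> with depth \<open>K\<close> imposes no constraint in the limit \<open>K \<rightarrow> \<infinity>\<close>.\<close>
    have bound: "prob ?D \<le> 1 - K / (x + K) * ((c - (y - x)) / c)" if K: "0 < K" for K
    proof -
      \<comment> \<open>The levels begin 0, x, y, and the barrier of stage 1 is x - (c - (y - x)) =
        y - c.\<close>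
      define a where "a j = (if j = 0 then 0 else x + (y - x) * (real j - 1))" for j :: nat
      define l where "l j = (if j = 0 then - K else a j - (c - (y - x)))" for j
      interpret level_ladder M F B a l
      proof
        show "a j < a (Suc j)" for j using 4 by (auto simp: a_def algebra_simps)
        show "l j < a j" for j using 4 K by (auto simp: l_def a_def)
      qed (simp add: a_def)
      have a12: "a 1 = x" "a (Suc 0) = x" "a 2 = y" "a (Suc (Suc 0)) = y" by (simp_all add: a_def)
      have "?D \<subseteq> failing 2"
      proof
        fix \<omega> assume "\<omega> \<in> ?D"
        then obtain t where t: "\<omega> \<in> space M" "0 \<le> t" "running_sup B t \<omega> \<in> {x..<y}" "c \<le> running_sup B t \<omega> - B t \<omega>"
          by (auto simp: drops_def)
        then have "fails 1 \<omega> t" by (auto simp: fails_def a12 l_def)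
        then show "\<omega> \<in> failing 2" using t by (auto simp: failing_def intro!: exI[of _ "Suc 0"] exI[of _ t])
      qed
      then have "prob ?D \<le> prob (failing 2)" by (intro finite_measure_mono) auto
      also have "\<dots> = 1 - (\<Prod>i<2. (a i - l i) / (a (Suc i) - l i))"
        using prob_not_failing[of 2] by (simp add: prob_compl)
      also have "\<dots> = 1 - K / (x + K) * ((c - (y - x)) / c)"
        by (simp add: numeral_2_eq_2 a12 a_0 l_def)
      finally show ?thesis .
    qed
    have "(\<lambda>n. 1 - real (Suc n) / (x + real (Suc n)) * ((c - (y - x)) / c)) \<longlonglongrightarrow> 1 - 1 * ((c - (y - x)) / c)"
    proof (intro tendsto_intros)
      have "(\<lambda>n. real n / (x + real n)) \<longlonglongrightarrow> 1" by real_asymp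
      then show "(\<lambda>n. real (Suc n) / (x + real (Suc n))) \<longlonglongrightarrow> 1" by (rule LIMSEQ_Suc)
    qed
    then have "prob ?D \<le> 1 - 1 * ((c - (y - x)) / c)"
      by (rule LIMSEQ_le_const) (use bound in auto)
    also have "\<dots> = (y - x) / c" using c by (simp add: field_simps)
    finally show ?thesis .
  qed
qed

lemma prob_drops_Icc:
  assumes xy: "0 \<le> x" "x \<le> y" and c: "0 < c"
  shows "prob (drops {x..y} (\<lambda>_. c)) \<le> (y - x) / c"
proof (rule field_le_epsilon)
  fix e :: real assume e: "0 < e"
  have "0 < e * c" using e c by simp
  then have "prob (drops {x..y} (\<lambda>_. c)) \<le> prob (drops {x..<y + e * c} (\<lambda>_. c))"
    using c by (intro finite_measure_mono drops_mono sets_drops) auto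
  also from \<open>0 < e * c\<close> have "\<dots> \<le> (y + e * c - x) / c" using c xy by (intro prob_drops_Ico) linarith+
  also have "\<dots> = (y - x) / c + e" using c by (simp add: field_simps)
  finally show "prob (drops {x..y} (\<lambda>_. c)) \<le> (y - x) / c + e" .
qed

text \<open>E is covered by countably many non-overlapping intervals of total length at most |E| + e
  c, to which the interval bound and countable subadditivity apply.\<close>

lemma prob_drops_le_measure:
  assumes E: "E \<in> sets borel" "E \<subseteq> {0..X}" and c: "0 < c"
  shows "prob (drops E (\<lambda>_. c)) \<le> measure lborel E / c"
proof (rule field_le_epsilon)
  fix e :: real assume e: "0 < e"
  have lm: "E \<in> lmeasurable"
    using E by (intro bounded_set_imp_lmeasurable bounded_subset[OF bounded_closed_interval]) auto
  obtain D where D: "countable D" "\<And>K. K \<in> D \<Longrightarrow> K \<subseteq> cbox 0 X \<and> K \<noteq> {} \<and> (\<exists>c d. K = cbox c d)"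
    "pairwise (\<lambda>A B. interior A \<inter> interior B = {}) D"
    "E \<subseteq> \<Union>D" "\<Union>D \<in> lmeasurable" "measure lebesgue (\<Union>D) \<le> measure lebesgue E + e * c"
  proof (rule measurable_outer_intervals_bounded[OF lm, of 0 X "e * c"])
    show "E \<subseteq> cbox 0 X" "0 < e * c" using E(2) e c by auto
  qed (use that in blast)
  \<comment> \<open>An enumeration padded with empty sets, since D may be finite.\<close>
  define f where "f n = (if n \<in> to_nat_on D ` D then from_nat_into D n else {})" for n
  have f_D: "f n \<in> D \<or> f n = {}" for n using D(1) by (auto simp: f_def)
  have UN_f: "(\<Union>n. f n) = \<Union>D"
  proof
    show "\<Union>D \<subseteq> (\<Union>n. f n)"
    proof
      fix x assume "x \<in> \<Union>D"
      then obtain K where K: "K \<in> D" "x \<in> K" by blast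
      then have "f (to_nat_on D K) = K" using D(1) by (auto simp: f_def)
      then show "x \<in> (\<Union>n. f n)" using K by blast
    qed
  qed (use f_D in blast)
  have icc: "\<exists>x y. f n = {x..y} \<and> (f n \<noteq> {} \<longrightarrow> 0 \<le> x \<and> x \<le> y)" for n
  proof (cases "f n = {}")
    case True
    then show ?thesis by (intro exI[of _ 1] exI[of _ 0]) auto
  next
    case False
    then obtain x y where xy: "f n = cbox x y" using f_D[of n] D(2) by blast
    with False have "x \<le> y" "x \<in> f n" by (auto simp: cbox_interval)
    moreover have "f n \<subseteq> cbox 0 X" using False f_D D(2) by blast
    ultimately have "0 \<le> x" "x \<le> y" by (auto simp: cbox_interval subset_eq)
    then show ?thesis using xy by (intro exI[of _ x] exI[of _ y]) (simp add: cbox_interval)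
  qed
  \<comment> \<open>The closed intervals may share endpoints. Their intersections are convex with
    empty interior, hence null, so the lengths still add up.\<close>
  have neg: "negligible (f m \<inter> f n)" if "m \<noteq> n" for m n
  proof (cases "f m = {} \<or> f n = {}")
    case False
    then have mn: "m \<in> to_nat_on D ` D" "n \<in> to_nat_on D ` D" by (auto simp: f_def)
    then have "f m \<noteq> f n" using that D(1) by (auto simp: f_def)
    moreover have "f m \<in> D" "f n \<in> D" using False f_D by blast+
    ultimately have int: "interior (f m) \<inter> interior (f n) = {}" using D(3) by (auto simp: pairwise_def)
    obtain x y where "f m = cbox x y" using D(2)[OF \<open>f m \<in> D\<close>] by blast
    moreover obtain x' y' where "f n = cbox x' y'" using D(2)[OF \<open>f n \<in> D\<close>] by blast
    ultimately have "convex (f m \<inter> f n)" by (simp add: convex_Int)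
    moreover have "interior (f m \<inter> f n) = {}" using int by simp
    ultimately show ?thesis by (simp add: negligible_convex_interior)
  qed auto
  have sums: "(\<lambda>n. measure lebesgue (f n)) sums measure lebesgue (\<Union>n. f n)"
  proof (rule measure_countable_negligible_Union_bounded)
    show "f n \<in> lmeasurable" for n using icc[of n] by auto
    show "pairwise (\<lambda>m n. negligible (f m \<inter> f n)) UNIV" using neg by (auto simp: pairwise_def)
    show "bounded (\<Union>n. f n)" unfolding UN_f using D(2) by (intro bounded_subset[OF bounded_cbox[of 0 X]]) blast
  qed
  have le: "prob (drops (f n) (\<lambda>_. c)) \<le> measure lebesgue (f n) / c" for n
  proof -
    obtain x y where xy: "f n = {x..y}" "f n \<noteq> {} \<Longrightarrow> 0 \<le> x \<and> x \<le> y" using icc by blast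
    show ?thesis
    proof (cases "f n = {}")
      case True
      then show ?thesis by (simp add: drops_def)
    next
      case False
      then have "0 \<le> x" "x \<le> y" using xy(2) by auto
      then show ?thesis using prob_drops_Icc[of x y c] c by (simp add: xy(1))
    qed
  qed
  have sm: "drops (f n) (\<lambda>_. c) \<in> sets M" for n
  proof -
    obtain x y where "f n = {x..y}" using icc by blast
    then have "f n \<in> sets borel" by simp
    then show ?thesis using c by (intro sets_drops) auto
  qed
  have sums': "(\<lambda>n. measure lebesgue (f n) / c) sums (measure lebesgue (\<Union>D) / c)"
    using sums_divide[OF sums, of c] by (simp add: UN_f)
  have summable: "summable (\<lambda>n. prob (drops (f n) (\<lambda>_. c)))"
    using le by (intro summable_comparison_test'[OF sums_summable[OF sums'], of 0]) auto
  have "drops E (\<lambda>_. c) \<subseteq> (\<Union>n. drops (f n) (\<lambda>_. c))"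
    unfolding drops_UN[of f UNIV, symmetric] UN_f using D(4) by (intro drops_mono) auto
  then have "prob (drops E (\<lambda>_. c)) \<le> prob (\<Union>n. drops (f n) (\<lambda>_. c))"
    using sm by (intro finite_measure_mono) auto
  also have "\<dots> \<le> (\<Sum>n. prob (drops (f n) (\<lambda>_. c)))"
    using sm summable by (intro finite_measure_subadditive_countably) auto
  also have "\<dots> \<le> measure lebesgue (\<Union>D) / c"
    using suminf_le[OF le summable sums_summable[OF sums']] sums_unique[OF sums'] by simp
  also have "\<dots> \<le> (measure lebesgue E + e * c) / c" using D(6) c by (simp add: divide_right_mono)
  also have "\<dots> = measure lborel E / c + e" using c E(1) by (simp add: add_divide_distrib)
  finally show "prob (drops E (\<lambda>_. c)) \<le> measure lborel E / c + e" .
qed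

text \<open>Used at levels where g lies below a truncation threshold and no constant depth is
  available. The factor 2 is harmless, as the integral over these levels tends to 0.\<close>

lemma emeasure_drops_le:
  assumes [measurable]: "E \<in> sets borel" "g \<in> borel_measurable borel"
    and E: "E \<subseteq> {0..X}" and g: "\<And>y. y \<in> E \<Longrightarrow> 0 < g y \<and> g y \<le> 1"
  shows "emeasure M (drops E g) \<le> 2 * (\<integral>\<^sup>+y\<in>E. ennreal (1 / g y) \<partial>lborel)"
proof -
  \<comment> \<open>On the dyadic layers of \<open>1 / g\<close> the constant bound loses at most a factor 2.\<close>
  define A where "A k = {y\<in>E. 2 ^ k \<le> 1 / g y \<and> 1 / g y < 2 ^ Suc k}" for k :: nat
  have A[measurable]: "A k \<in> sets borel" for k unfolding A_def by measurable
  have UN_A: "E = (\<Union>k. A k)"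
  proof -
    have "\<exists>k. y \<in> A k" if y: "y \<in> E" for y
    proof -
      have ge: "1 \<le> 1 / g y" using g[OF y] by simp
      \<comment> \<open>The least such n is positive because g is at most 1, so its predecessor is
        the index of the layer.\<close>
      obtain n where n: "1 / g y < 2 ^ n" "\<And>m. m < n \<Longrightarrow> \<not> 1 / g y < 2 ^ m"
        using real_arch_pow[of 2 "1 / g y"] exists_least_iff[of "\<lambda>n. 1 / g y < 2 ^ n"] by auto
      with ge obtain k where "n = Suc k" by (cases n) auto
      with n y show ?thesis by (auto simp: A_def not_less intro!: exI[of _ k])
    qed
    then show ?thesis by (auto simp: A_def)
  qed
  have disj: "disjoint_family A"
    unfolding disjoint_family_on_def
  proof (intro ballI impI)
    have False if "j < k" "y \<in> A j" "y \<in> A k" for j k y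
    proof -
      have "(2::real) ^ Suc j \<le> 2 ^ k" using that(1) by (intro power_increasing) auto
      then show False using that(2,3) by (auto simp: A_def)
    qed
    then show "A j \<inter> A k = {}" if "j \<noteq> k" for j k using that by (metis disjoint_iff linorder_neqE_nat)
  qed
  define \<nu> where "\<nu> = density lborel (\<lambda>y. ennreal (1 / g y))"
  have \<nu>: "emeasure \<nu> H = (\<integral>\<^sup>+y\<in>H. ennreal (1 / g y) \<partial>lborel)" if "H \<in> sets borel" for H
    unfolding \<nu>_def using that by (subst emeasure_density) (auto simp: mult.commute)
  have sm: "drops (A k) g \<in> sets M" for k
    using g by (intro sets_drops) (auto simp: A_def)
  have le: "emeasure M (drops (A k) g) \<le> 2 * emeasure \<nu> (A k)" for k
  proof -
    have "emeasure M (drops (A k) g) \<le> emeasure M (drops (A k) (\<lambda>_. 1 / 2 ^ Suc k))"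
    proof (intro emeasure_mono drops_mono sets_drops)
      show "1 / 2 ^ Suc k \<le> g y" if "y \<in> A k" for y
      proof -
        have "0 < g y" "1 / g y < 2 ^ Suc k" using that g by (auto simp: A_def)
        then show ?thesis by (simp add: field_simps)
      qed
    qed auto
    also have "\<dots> \<le> ennreal (measure lborel (A k) / (1 / 2 ^ Suc k))"
      unfolding emeasure_eq_measure using E
      by (intro ennreal_leI prob_drops_le_measure[where X=X]) (auto simp: A_def)
    also have "\<dots> = 2 * (ennreal (2 ^ k) * emeasure lborel (A k))"
    proof -
      have "emeasure lborel (A k) \<le> emeasure lborel {0..X}" using E by (intro emeasure_mono) (auto simp: A_def)
      also have "\<dots> < \<infinity>" by (simp add: emeasure_lborel_Icc_eq)
      finally have "emeasure lborel (A k) = ennreal (measure lborel (A k))"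
        by (intro emeasure_eq_ennreal_measure) auto
      then show ?thesis by (simp add: ennreal_mult[symmetric] mult_ac flip: ennreal_numeral)
    qed
    also have "ennreal (2 ^ k) * emeasure lborel (A k) \<le> emeasure \<nu> (A k)"
    proof -
      have "ennreal (2 ^ k) * emeasure lborel (A k) = (\<integral>\<^sup>+y\<in>A k. ennreal (2 ^ k) \<partial>lborel)"
        by (simp add: nn_integral_cmult_indicator)
      also have "\<dots> \<le> emeasure \<nu> (A k)"
        by (subst \<nu>) (auto intro!: nn_integral_mono ennreal_leI simp: A_def indicator_def)
      finally show ?thesis .
    qed
    finally show ?thesis by (simp add: mult_left_mono)
  qed
  have "emeasure M (drops E g) \<le> (\<Sum>k. emeasure M (drops (A k) g))"
    unfolding UN_A drops_UN using sm by (intro emeasure_subadditive_countably) auto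
  also have "\<dots> \<le> (\<Sum>k. 2 * emeasure \<nu> (A k))" by (intro suminf_le le) auto
  also have "\<dots> = 2 * emeasure \<nu> (\<Union>k. A k)"
    using disj by (subst ennreal_suminf_cmult, subst suminf_emeasure) (auto simp: \<nu>_def)
  finally show ?thesis by (simp only: UN_A[symmetric] \<nu>[OF assms(1)])
qed

end

section \<open>Continuous gap functions\<close>

lemma integral_stepwise:
  fixes f :: "real \<Rightarrow> real"
  assumes f: "continuous_on UNIV f" and h: "0 < h"
  shows "integral {0..h * real (Suc n)} f = integral {0..h * real n} f + integral {h * real n..h * real (Suc n)} f"
    and "(\<And>x. x \<in> {h * real n..h * real (Suc n)} \<Longrightarrow> f x \<le> w) \<Longrightarrow> integral {h * real n..h * real (Suc n)} f \<le> h * w"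
    and "(\<And>x. x \<in> {h * real n..h * real (Suc n)} \<Longrightarrow> w \<le> f x) \<Longrightarrow> h * w \<le> integral {h * real n..h * real (Suc n)} f"
proof -
  have le: "h * real n \<le> h * real (Suc n)" using h by simp
  have int: "f integrable_on {x..y}" for x y
    by (rule integrable_continuous_interval) (rule continuous_on_subset[OF f], simp)
  show "integral {0..h * real (Suc n)} f = integral {0..h * real n} f + integral {h * real n..h * real (Suc n)} f"
    using Henstock_Kurzweil_Integration.integral_combine[OF _ le int, of 0] h by simp
  have const: "integral {h * real n..h * real (Suc n)} (\<lambda>_. w) = h * w"
    using le by (simp add: algebra_simps)
  show "integral {h * real n..h * real (Suc n)} f \<le> h * w" if "\<And>x. x \<in> {h * real n..h * real (Suc n)} \<Longrightarrow> f x \<le> w"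
    unfolding const[symmetric] using that by (intro integral_le int integrable_const_ivl) auto
  show "h * w \<le> integral {h * real n..h * real (Suc n)} f" if "\<And>x. x \<in> {h * real n..h * real (Suc n)} \<Longrightarrow> w \<le> f x"
    unfolding const[symmetric] using that by (intro integral_le int integrable_const_ivl) auto
qed

text \<open>Each factor is compared with the integral over its own cell, so the product becomes an
  exponential of a Riemann sum. The next lemma is the reverse bound.\<close>

lemma prod_le_exp_integral:
  fixes f :: "real \<Rightarrow> real"
  assumes f: "continuous_on UNIV f" and h: "0 < h"
    and r: "\<And>i. i < n \<Longrightarrow> 0 \<le> r i \<and> r i \<le> exp (- (h * w i))"
    and w: "\<And>i x. i < n \<Longrightarrow> x \<in> {h * real i..h * real (Suc i)} \<Longrightarrow> f x \<le> w i"
  shows "(\<Prod>i<n. r i) \<le> exp (- integral {0..h * real n} f)"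
  using r w
proof (induction n)
  case (Suc n)
  have "integral {h * real n..h * real (Suc n)} f \<le> h * w n"
    using Suc.prems(2) by (intro integral_stepwise[OF f h]) blast
  then have "r n \<le> exp (- integral {h * real n..h * real (Suc n)} f)"
    using Suc.prems(1)[of n] by (meson exp_le_cancel_iff lessI neg_le_iff_le order_trans)
  then have "(\<Prod>i<n. r i) * r n \<le> exp (- integral {0..h * real n} f) * exp (- integral {h * real n..h * real (Suc n)} f)"
    using Suc.IH Suc.prems by (intro mult_mono) auto
  also have "\<dots> = exp (- integral {0..h * real (Suc n)} f)"
    unfolding integral_stepwise(1)[OF f h] by (simp add: exp_add[symmetric])
  finally show ?case by simp
qed simp

lemma exp_integral_le_prod:
  fixes f :: "real \<Rightarrow> real"
  assumes f: "continuous_on UNIV f" and h: "0 < h"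
    and r: "\<And>i. i < n \<Longrightarrow> exp (- (h * w i)) \<le> r i"
    and w: "\<And>i x. i < n \<Longrightarrow> x \<in> {h * real i..h * real (Suc i)} \<Longrightarrow> w i \<le> f x"
  shows "exp (- integral {0..h * real n} f) \<le> (\<Prod>i<n. r i)"
  using r w
proof (induction n)
  case (Suc n)
  have "h * w n \<le> integral {h * real n..h * real (Suc n)} f"
    using Suc.prems(2) by (intro integral_stepwise[OF f h]) blast
  then have "exp (- integral {h * real n..h * real (Suc n)} f) \<le> r n"
    using Suc.prems(1)[of n] by (meson exp_le_cancel_iff lessI neg_le_iff_le order_trans)
  moreover have "exp (- integral {0..h * real (Suc n)} f)
      = exp (- integral {0..h * real n} f) * exp (- integral {h * real n..h * real (Suc n)} f)"
    unfolding integral_stepwise(1)[OF f h] by (simp add: exp_add[symmetric])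
  moreover have "exp (- integral {0..h * real n} f) \<le> (\<Prod>i<n. r i)" using Suc by simp
  moreover have "0 \<le> (\<Prod>i<n. r i)" using calculation(3) by (meson exp_ge_zero order_trans)
  ultimately show ?case by (simp add: mult_mono)
qed simp

context unbounded_local_martingale
begin

text \<open>One mesh and two ladders, with barriers slightly too deep and slightly too shallow. The
  margin e absorbs the oscillation of g on a cell (e/4), the safety in the barrier (e/4) and the
  mesh h < e/4.\<close>

lemma prob_survive_continuous:
  assumes g: "continuous_on UNIV g" "\<And>y. c \<le> g y" and e: "0 < e" "e < c" and X: "0 < X"
  shows "exp (- integral {0..X} (\<lambda>y. 1 / (g y - e))) \<le> prob (space M - drops {0..<X} g)"
    and "prob (space M - drops {0..<X} g) \<le> exp (- integral {0..X} (\<lambda>y. 1 / (g y + e)))"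
proof -
  have gpos: "e < g y" for y using g(2)[of y] e by linarith
  have cont: "continuous_on UNIV (\<lambda>y. 1 / (g y - e))" "continuous_on UNIV (\<lambda>y. 1 / (g y + e))"
    by (intro continuous_intros g(1); use gpos e in \<open>auto simp: less_imp_neq[symmetric] add_pos_pos\<close>;
        smt (verit) gpos e)+
  have gm: "g \<in> borel_measurable borel" using g(1) by (rule borel_measurable_continuous_onI)
  have drops: "drops {0..<X} g \<in> sets M"
    by (rule sets_drops[OF gm]) (use gpos e in \<open>auto intro: less_trans\<close>)
  obtain d where d: "0 < d" "\<And>x y. x \<in> {0..X} \<Longrightarrow> y \<in> {0..X} \<Longrightarrow> \<bar>y - x\<bar> < d \<Longrightarrow> \<bar>g y - g x\<bar> < e / 4"
    using compact_uniformly_continuous[OF continuous_on_subset[OF g(1)] compact_Icc, of 0 X] e(1)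
    unfolding uniformly_continuous_on_def dist_real_def
    by (metis divide_pos_pos subset_UNIV zero_less_numeral)
  obtain n :: nat where n: "X / min d (e/4) < real n" using reals_Archimedean2 by blast
  define h where "h = X / real n"
  have n0: "0 < real n" using n X d(1) e(1) by (smt (verit) divide_pos_pos zero_less_numeral)
  have h: "0 < h" "h < d" "h < e/4" "h * real n = X"
  proof -
    have "0 < min d (e/4)" using d(1) e(1) by simp
    then have "X < min d (e/4) * real n" using n by (metis mult.commute pos_divide_less_eq)
    then have "h < min d (e/4)" by (simp only: h_def pos_divide_less_eq[OF n0])
    then show "0 < h" "h < d" "h < e/4" "h * real n = X" using n0 X by (auto simp: h_def)
  qed
  have near: "\<bar>g x - g (h * real i)\<bar> < e / 4" if "i < n" "h * real i \<le> x" "x \<le> h * real (Suc i)" for i x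
  proof -
    have "h * real (Suc i) \<le> X" using that(1) h(1) unfolding h(4)[symmetric] by (intro mult_left_mono) auto
    moreover have "h * real (Suc i) = h * real i + h" by (simp add: algebra_simps)
    moreover have "0 \<le> h * real i" using h(1) by simp
    ultimately have "x \<in> {0..X}" "h * real i \<in> {0..X}" "\<bar>x - h * real i\<bar> < d"
      using that(2,3) h(1,2) unfolding atLeastAtMost_iff by linarith+
    then show ?thesis by (intro d(2))
  qed
  show "prob (space M - drops {0..<X} g) \<le> exp (- integral {0..X} (\<lambda>y. 1 / (g y + e)))"
  proof -
    \<comment> \<open>A fall by \<open>w i\<close> below the bottom of cell i exceeds g at every
      level of the cell, so each failure is a genuine drop.\<close>
    define w where "w i = g (h * real i) + e / 4" for i :: nat
    have w: "0 < w i" for i using gpos[of "h * real i"] e(1) by (simp add: w_def)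
    interpret level_ladder M F B "\<lambda>j. h * real j" "\<lambda>j. h * real j - w j"
      by unfold_locales (use h(1) w in \<open>auto simp: algebra_simps\<close>)
    have "failing n \<subseteq> drops {0..<X} g"
    proof
      fix \<omega> assume "\<omega> \<in> failing n"
      then obtain j t where j: "\<omega> \<in> space M" "j < n" "0 \<le> t" "fails j \<omega> t" by (auto simp: failing_def)
      let ?S = "running_sup B t \<omega>"
      have S: "h * real j \<le> ?S" "?S < h * real (Suc j)" "B t \<omega> \<le> h * real j - w j"
        using j(4) by (auto simp: fails_def)
      have "h * real (Suc j) \<le> X" using j(2) h(1) unfolding h(4)[symmetric] by (intro mult_left_mono) auto
      moreover have "0 \<le> h * real j" using h(1) by simp
      moreover have "g ?S \<le> w j" using near[OF j(2) S(1) less_imp_le[OF S(2)]] unfolding w_def by linarith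
      ultimately show "\<omega> \<in> drops {0..<X} g" using j S by (auto simp: drops_def intro!: exI[of _ t])
    qed
    then have "prob (space M - drops {0..<X} g) \<le> prob (space M - failing n)"
      by (intro finite_measure_mono) auto
    also have "\<dots> = (\<Prod>i<n. w i / (w i + h))"
      unfolding prob_not_failing by (intro prod.cong refl) (simp add: algebra_simps)
    also have "\<dots> \<le> exp (- integral {0..h * real n} (\<lambda>y. 1 / (g y + e)))"
    proof (rule prod_le_exp_integral[where w="\<lambda>i. 1 / (w i + h)", OF cont(2) h(1)])
      fix i x
      \<comment> \<open>The inequality 1 + z \<le> exp z is used with z = - h / (w + h).\<close>
      have "w i / (w i + h) = 1 + - (h * (1 / (w i + h)))" using w[of i] h(1) by (simp add: field_simps)
      then have "w i / (w i + h) \<le> exp (- (h * (1 / (w i + h))))" by (simp only: exp_ge_add_one_self)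
      then show "0 \<le> w i / (w i + h) \<and> w i / (w i + h) \<le> exp (- (h * (1 / (w i + h))))"
        using w[of i] h(1) by simp
      assume "i < n" "x \<in> {h * real i..h * real (Suc i)}"
      then have "\<bar>g x - g (h * real i)\<bar> < e / 4" by (intro near) auto
      then have "w i + h \<le> g x + e" using h(3) e(1) unfolding w_def by linarith
      then show "1 / (g x + e) \<le> 1 / (w i + h)" using w[of i] h(1) by (intro divide_left_mono) auto
    qed
    finally show ?thesis by (simp only: h(4))
  qed
  show "exp (- integral {0..X} (\<lambda>y. 1 / (g y - e))) \<le> prob (space M - drops {0..<X} g)"
  proof -
    \<comment> \<open>The extra h accounts for the supremum lying up to h above the bottom of its
      cell: every drop then reaches the barrier.\<close>
    define w where "w i = g (h * real i) - e / 4 - h" for i :: nat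
    have w: "0 < w i" for i using gpos[of "h * real i"] e(1) h(3) by (simp add: w_def)
    interpret level_ladder M F B "\<lambda>j. h * real j" "\<lambda>j. h * real j - w j"
      by unfold_locales (use h(1) w in \<open>auto simp: algebra_simps\<close>)
    have "drops {0..<X} g \<subseteq> failing n"
    proof
      fix \<omega> assume "\<omega> \<in> drops {0..<X} g"
      then obtain t where t: "\<omega> \<in> space M" "0 \<le> t" "running_sup B t \<omega> \<in> {0..<X}"
          "g (running_sup B t \<omega>) \<le> running_sup B t \<omega> - B t \<omega>" by (auto simp: drops_def)
      let ?S = "running_sup B t \<omega>"
      obtain j where j: "j < n" "h * real j \<le> ?S" "?S < h * real (Suc j)"
        using stage_exists[of ?S n] t(3) h(4) by auto
      have "w j + h \<le> g ?S" using near[OF j(1,2) less_imp_le[OF j(3)]] unfolding w_def by linarith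
      moreover have "h * real (Suc j) = h * real j + h" by (simp add: algebra_simps)
      ultimately have "B t \<omega> \<le> h * real j - w j" using t(4) j(3) by linarith
      then show "\<omega> \<in> failing n" using t j by (auto simp: failing_def fails_def)
    qed
    then have "prob (space M - failing n) \<le> prob (space M - drops {0..<X} g)"
      using drops by (intro finite_measure_mono) auto
    moreover have "prob (space M - failing n) = (\<Prod>i<n. w i / (w i + h))"
      unfolding prob_not_failing by (intro prod.cong refl) (simp add: algebra_simps)
    moreover have "exp (- integral {0..h * real n} (\<lambda>y. 1 / (g y - e))) \<le> (\<Prod>i<n. w i / (w i + h))"
    proof (rule exp_integral_le_prod[where w="\<lambda>i. 1 / w i", OF cont(1) h(1)])
      fix i x
      \<comment> \<open>For the opposite direction the same inequality is used with z = h / w and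
        inverted.\<close>
      have "1 + h / w i \<le> exp (h / w i)" by (rule exp_ge_add_one_self)
      then have "inverse (exp (h / w i)) \<le> inverse (1 + h / w i)"
        using w[of i] h(1) by (intro le_imp_inverse_le) (auto intro: add_pos_pos)
      also have "inverse (1 + h / w i) = w i / (w i + h)" using w[of i] h(1) by (simp add: field_simps)
      finally show "exp (- (h * (1 / w i))) \<le> w i / (w i + h)" by (simp add: exp_minus)
      assume "i < n" "x \<in> {h * real i..h * real (Suc i)}"
      then have "\<bar>g x - g (h * real i)\<bar> < e / 4" by (intro near) auto
      then have "g x - e \<le> w i" using h(3) e(1) unfolding w_def by linarith
      then show "1 / w i \<le> 1 / (g x - e)" using w[of i] gpos[of x] by (intro divide_left_mono) auto
    qed
    ultimately show ?thesis by (simp only: h(4))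
  qed
qed

end

section \<open>Borel gap functions\<close>

text \<open>The real-valued exponent for gaps bounded away from 0; gaps that are merely positive
  require the \<open>ennreal\<close> integral.\<close>

definition gap_integral :: "real \<Rightarrow> (real \<Rightarrow> real) \<Rightarrow> real" where
  "gap_integral X g = (\<integral>y. indicator {0..X} y * (1 / g y) \<partial>lborel)"

lemma integrable_indicator_bounded:
  fixes f :: "real \<Rightarrow> real"
  assumes [measurable]: "f \<in> borel_measurable borel" and "\<And>y. \<bar>f y\<bar> \<le> C"
  shows "integrable lborel (\<lambda>y. indicator {0..X} y * f y)"
proof (rule Bochner_Integration.integrable_bound[where f="\<lambda>y. indicator {0..X} y * C"])
  show "integrable lborel (\<lambda>y. indicator {0..X} y * C :: real)"
    by (intro integrable_mult_left) (simp add: integrable_indicator_iff emeasure_lborel_Icc_eq)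
  show "AE y in lborel. norm (indicator {0..X} y * f y) \<le> norm (indicator {0..X} y * C)"
    using assms(2) by (intro AE_I2) (auto simp: indicator_def intro: order_trans[OF _ abs_ge_self])
qed simp

lemma gap_integral_tendsto:
  fixes g :: "real \<Rightarrow> real"
  assumes [measurable]: "\<And>n. f n \<in> borel_measurable borel" "g \<in> borel_measurable borel"
    and d: "0 < d" "\<And>n y. d \<le> f n y" "\<And>y. d \<le> g y"
    and lim: "AE y in lborel. (\<lambda>n::nat. f n y) \<longlonglongrightarrow> g y"
  shows "(\<lambda>n. gap_integral X (f n)) \<longlonglongrightarrow> gap_integral X g"
  unfolding gap_integral_def
proof (rule integral_dominated_convergence[where w="\<lambda>y. indicator {0..X} y * (1 / d)"])
  show "integrable lborel (\<lambda>y. indicator {0..X} y * (1 / d))"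
    by (rule integrable_indicator_bounded[where C="1 / d"]) (use d(1) in auto)
  show "AE y in lborel. (\<lambda>n. indicator {0..X} y * (1 / f n y)) \<longlonglongrightarrow> indicator {0..X} y * (1 / g y)"
    using lim
  proof eventually_elim
    fix y assume "(\<lambda>n. f n y) \<longlonglongrightarrow> g y"
    moreover have "g y \<noteq> 0" using d(1) d(3)[of y] by simp
    ultimately show "(\<lambda>n. indicator {0..X} y * (1 / f n y)) \<longlonglongrightarrow> indicator {0..X} y * (1 / g y)"
      by (intro tendsto_intros)
  qed
  show "AE y in lborel. norm (indicator {0..X} y * (1 / f n y)) \<le> indicator {0..X} y * (1 / d)" for n
  proof (rule AE_I2)
    fix y
    have "0 < f n y" using d(1) d(2)[of n y] by simp
    then show "norm (indicator {0..X} y * (1 / f n y)) \<le> indicator {0..X} y * (1 / d)"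
      using d(1) d(2)[of n y] by (auto simp: indicator_def intro!: divide_left_mono)
  qed
qed simp_all

lemma gap_integral_eq_integral:
  assumes g: "continuous_on UNIV g" and d: "0 < d" "\<And>y. d \<le> g y"
  shows "integral {0..X} (\<lambda>y. 1 / g y) = gap_integral X g"
proof -
  have [measurable]: "g \<in> borel_measurable borel" using g by (rule borel_measurable_continuous_onI)
  have "\<bar>1 / g y\<bar> \<le> 1 / d" for y
  proof -
    have "0 < g y" using d(1) d(2)[of y] by simp
    then show ?thesis using d(1) d(2)[of y] by (auto intro!: divide_left_mono)
  qed
  then have "integrable lborel (\<lambda>y. indicator {0..X} y * (1 / g y))"
    by (intro integrable_indicator_bounded) simp
  then have "set_integrable lborel {0..X} (\<lambda>y. 1 / g y)" by (simp add: set_integrable_def)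
  from set_borel_integral_eq_integral(2)[OF this] show ?thesis
    by (simp add: gap_integral_def set_lebesgue_integral_def)
qed

text \<open>\<open>measurable_on\<close> is by definition almost everywhere approximation by
  continuous functions. Taking the maximum with c keeps continuity, and keeps the limit because g is
  at least c.\<close>

lemma continuous_approximation:
  fixes g :: "real \<Rightarrow> real"
  assumes g: "g \<in> borel_measurable borel" "\<And>y. c \<le> g y"
  obtains k :: "nat \<Rightarrow> real \<Rightarrow> real" where "\<And>n. continuous_on UNIV (k n)" "\<And>n y. c \<le> k n y"
    "AE y in lborel. (\<lambda>n. k n y) \<longlonglongrightarrow> g y"
proof -
  have "g \<in> borel_measurable (lebesgue_on UNIV)"
    using g(1) by (simp add: measurable_completion lebesgue_on_UNIV_eq)
  then have "g measurable_on UNIV" by (simp add: measurable_on_iff_borel_measurable)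
  then obtain N h where N: "negligible N" "\<And>n. continuous_on UNIV (h n)"
    "\<And>x. x \<notin> N \<Longrightarrow> (\<lambda>n::nat. h n x) \<longlonglongrightarrow> g x"
    unfolding measurable_on_def by auto
  show ?thesis
  proof (rule that[of "\<lambda>n y. max c (h n y)"])
    show "continuous_on UNIV (\<lambda>y. max c (h n y))" for n by (intro continuous_intros N(2))
    have "AE y in lebesgue. (\<lambda>n. max c (h n y)) \<longlonglongrightarrow> g y"
    proof (rule AE_I')
      show "N \<in> null_sets lebesgue" using N(1) by (simp add: negligible_iff_null_sets)
      have "(\<lambda>n. max c (h n y)) \<longlonglongrightarrow> g y" if "y \<notin> N" for y
        using tendsto_max[OF tendsto_const N(3)[OF that], of c] g(2)[of y] by (simp add: max_def)
      then show "{y \<in> space lebesgue. \<not> (\<lambda>n. max c (h n y)) \<longlonglongrightarrow> g y} \<subseteq> N" by auto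
    qed
    then show "AE y in lborel. (\<lambda>n. max c (h n y)) \<longlonglongrightarrow> g y"
      by (simp add: AE_completion_iff)
  qed simp
qed

section \<open>Survival probabilities for Borel gaps\<close>

lemma exp_neg_finite: "I < \<infinity> \<Longrightarrow> exp_neg I = exp (- enn2real I)"
  by (auto simp: exp_neg_def)

lemma exp_neg_infinity: "exp_neg \<infinity> = 0"
  by (simp add: exp_neg_def)

context unbounded_local_martingale
begin

text \<open>The comparison device: A and D are drops for two gaps, and C collects the drops at the
  exceptional levels where the gaps do not compare.\<close>

lemma prob_compl_drops_le:
  assumes A: "A \<subseteq> D \<union> C" "D \<in> sets M" "C \<in> sets M" "A \<in> sets M"
  shows "prob (space M - D) \<le> prob (space M - A) + prob C"
proof -
  have "prob (space M - D) \<le> prob ((space M - A) \<union> C)"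
    using A sets.sets_into_space by (intro finite_measure_mono) auto
  also have "\<dots> \<le> prob (space M - A) + prob C" using A by (intro measure_Un_le) auto
  finally show ?thesis .
qed

text \<open>For fixed e the approximation index n goes to infinity, which removes the exceptional
  levels; only then does e tend to 0. At an exceptional level each gap whose drop has to be covered
  is at least c, so that drop has depth at least c.\<close>

lemma prob_survive_bounded_below:
  assumes g[measurable]: "g \<in> borel_measurable borel" and c: "0 < c" "\<And>y. c \<le> g y" and X: "0 < X"
  shows "prob (space M - drops {0..<X} g) = exp (- gap_integral X g)"
proof -
  let ?p = "prob (space M - drops {0..<X} g)"
  have sets: "drops E f \<in> sets M"
    if "f \<in> borel_measurable borel" "E \<in> sets borel" "\<And>y. 0 < f y" for E f
    using that by (intro sets_drops)
  obtain k where k: "\<And>n. continuous_on UNIV (k n)" "\<And>n y. c \<le> k n y"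
    "AE y in lborel. (\<lambda>n. k n y) \<longlonglongrightarrow> g y"
    by (rule continuous_approximation[OF g c(2)]) (rule that; assumption)
  have km[measurable]: "k n \<in> borel_measurable borel" for n using k(1) by (rule borel_measurable_continuous_onI)
  have k0: "0 < k n y" and g0: "0 < g y" for n y
    using c(1) k(2)[of n y] c(2)[of y] by linarith+
  \<comment> \<open>One e pays for replacing g by \<open>k n\<close> off the exceptional set, the
    other is the margin in the continuous case.\<close>
  have bounds: "exp (- gap_integral X (\<lambda>y. g y - 2 * e)) \<le> ?p \<and> ?p \<le> exp (- gap_integral X (\<lambda>y. g y + 2 * e))"
    if e: "0 < e" "2 * e < c" for e
  proof -
    define E where "E n = {y\<in>{0..X}. e < \<bar>k n y - g y\<bar>}" for n
    have E[measurable]: "E n \<in> sets borel" for n unfolding E_def by measurable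
    \<comment> \<open>Almost everywhere convergence on a bounded interval gives convergence in
      measure, by dominated convergence.\<close>
    have E_lim: "(\<lambda>n. measure lborel (E n)) \<longlonglongrightarrow> 0"
    proof -
      have "(\<lambda>n. \<integral>y. (indicator (E n) y :: real) \<partial>lborel) \<longlonglongrightarrow> (\<integral>y. 0 \<partial>(lborel :: real measure))"
      proof (rule integral_dominated_convergence[where w="\<lambda>y. indicator {0..X} y * 1"])
        show "integrable lborel (\<lambda>y. indicator {0..X} y * 1 :: real)"
          by (rule integrable_indicator_bounded[where C=1]) auto
        show "AE y in lborel. (\<lambda>n. indicator (E n) y :: real) \<longlonglongrightarrow> 0"
          using k(3)
        proof eventually_elim
          fix y assume "(\<lambda>n. k n y) \<longlonglongrightarrow> g y"
          then have "\<forall>\<^sub>F n in sequentially. dist (k n y) (g y) < e" using e(1) by (rule tendstoD)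
          then show "(\<lambda>n. indicator (E n) y :: real) \<longlonglongrightarrow> 0"
            by (intro tendsto_eventually) (auto elim!: eventually_mono simp: E_def dist_real_def)
        qed
      qed (auto simp: E_def indicator_def)
      then show ?thesis by simp
    qed
    have drops_E: "prob (drops (E n) (\<lambda>_. c)) \<le> measure lborel (E n) / c" for n
      using c(1) by (intro prob_drops_le_measure[where X=X]) (auto simp: E_def)
    have upper: "?p \<le> exp (- gap_integral X (\<lambda>y. k n y + 2 * e)) + measure lborel (E n) / c" for n
    proof -
      have "?p \<le> prob (space M - drops {0..<X} (\<lambda>y. k n y + e)) + prob (drops (E n) (\<lambda>_. c))"
      proof (rule prob_compl_drops_le)
        show "drops {0..<X} (\<lambda>y. k n y + e) \<subseteq> drops {0..<X} g \<union> drops (E n) (\<lambda>_. c)"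
        proof
          fix \<omega> assume "\<omega> \<in> drops {0..<X} (\<lambda>y. k n y + e)"
          then obtain t where t: "\<omega> \<in> space M" "0 \<le> t" "running_sup B t \<omega> \<in> {0..<X}"
            "k n (running_sup B t \<omega>) + e \<le> running_sup B t \<omega> - B t \<omega>" by (auto simp: drops_def)
          show "\<omega> \<in> drops {0..<X} g \<union> drops (E n) (\<lambda>_. c)"
          proof (cases "running_sup B t \<omega> \<in> E n")
            case True
            then have "\<omega> \<in> drops (E n) (\<lambda>_. c)"
              using t k(2)[of n "running_sup B t \<omega>"] e unfolding drops_def by (auto intro!: exI[of _ t])
            then show ?thesis ..
          next
            case False
            then have "\<omega> \<in> drops {0..<X} g" using t unfolding drops_def by (auto simp: E_def intro!: exI[of _ t])
            then show ?thesis ..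
          qed
        qed
        show "drops {0..<X} (\<lambda>y. k n y + e) \<in> sets M"
          using k0 e(1) by (intro sets) (auto intro: add_pos_pos)
        show "drops {0..<X} g \<in> sets M" "drops (E n) (\<lambda>_. c) \<in> sets M"
          using c(1) g0 by (auto intro!: sets)
      qed
      also have "prob (space M - drops {0..<X} (\<lambda>y. k n y + e)) \<le> exp (- integral {0..X} (\<lambda>y. 1 / (k n y + e + e)))"
        using e k(2) X by (intro prob_survive_continuous[where c="c + e"] continuous_intros k(1)) auto
      also have "(\<lambda>y. 1 / (k n y + e + e)) = (\<lambda>y. 1 / (k n y + 2 * e))" by (simp add: fun_eq_iff algebra_simps)
      also have "integral {0..X} \<dots> = gap_integral X (\<lambda>y. k n y + 2 * e)"
        using k(2) e c(1) by (intro gap_integral_eq_integral[where d=c] continuous_intros k(1)) (auto intro: add_increasing2)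
      finally show ?thesis using drops_E[of n] by linarith
    qed
    have lower: "exp (- gap_integral X (\<lambda>y. k n y - 2 * e)) \<le> ?p + measure lborel (E n) / c" for n
    proof -
      have ke: "c - e \<le> k n y - e" "c - 2 * e \<le> k n y - 2 * e" for y using k(2)[of n y] by auto
      have "(\<lambda>y. k n y - 2 * e) = (\<lambda>y. k n y - e - e)" by (simp add: fun_eq_iff)
      then have eq: "gap_integral X (\<lambda>y. k n y - 2 * e) = integral {0..X} (\<lambda>y. 1 / (k n y - e - e))"
        using ke e gap_integral_eq_integral[of "\<lambda>y. k n y - 2 * e" "c - 2 * e" X]
        by (simp add: continuous_intros k(1))
      have "exp (- integral {0..X} (\<lambda>y. 1 / (k n y - e - e))) \<le> prob (space M - drops {0..<X} (\<lambda>y. k n y - e))"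
        using e ke X by (intro prob_survive_continuous[where c="c - e"] continuous_intros k(1)) auto
      moreover have "prob (space M - drops {0..<X} (\<lambda>y. k n y - e)) \<le> ?p + prob (drops (E n) (\<lambda>_. c))"
      proof (rule prob_compl_drops_le)
        show "drops {0..<X} g \<subseteq> drops {0..<X} (\<lambda>y. k n y - e) \<union> drops (E n) (\<lambda>_. c)"
        proof
          fix \<omega> assume "\<omega> \<in> drops {0..<X} g"
          then obtain t where t: "\<omega> \<in> space M" "0 \<le> t" "running_sup B t \<omega> \<in> {0..<X}"
            "g (running_sup B t \<omega>) \<le> running_sup B t \<omega> - B t \<omega>" by (auto simp: drops_def)
          show "\<omega> \<in> drops {0..<X} (\<lambda>y. k n y - e) \<union> drops (E n) (\<lambda>_. c)"
          proof (cases "running_sup B t \<omega> \<in> E n")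
            case True
            then have "\<omega> \<in> drops (E n) (\<lambda>_. c)"
              using t c(2)[of "running_sup B t \<omega>"] unfolding drops_def by (auto intro!: exI[of _ t])
            then show ?thesis ..
          next
            case False
            then have "\<omega> \<in> drops {0..<X} (\<lambda>y. k n y - e)" using t unfolding drops_def by (auto simp: E_def intro!: exI[of _ t])
            then show ?thesis ..
          qed
        qed
        show "drops {0..<X} (\<lambda>y. k n y - e) \<in> sets M" using ke e by (intro sets less_le_trans[OF _ ke(1)]) auto
        show "drops {0..<X} g \<in> sets M" "drops (E n) (\<lambda>_. c) \<in> sets M"
          using c(1) g0 by (auto intro!: sets)
      qed
      ultimately show ?thesis unfolding eq using drops_E[of n] by linarith
    qed
    have lim: "(\<lambda>n. gap_integral X (\<lambda>y. k n y + b)) \<longlonglongrightarrow> gap_integral X (\<lambda>y. g y + b)" if b: "- c < b" for b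
    proof (rule gap_integral_tendsto[where d="c + b"])
      show "AE y in lborel. (\<lambda>n. k n y + b) \<longlonglongrightarrow> g y + b"
        using k(3) by eventually_elim (intro tendsto_intros)
    qed (use b k(2) c(2) in auto)
    have "?p \<le> exp (- gap_integral X (\<lambda>y. g y + 2 * e)) + 0 / c"
      by (rule LIMSEQ_le_const[OF tendsto_add[OF tendsto_exp[OF tendsto_minus[OF lim]] tendsto_divide[OF E_lim tendsto_const]]])
         (use upper e c in auto)
    moreover have "exp (- gap_integral X (\<lambda>y. g y + - 2 * e)) \<le> ?p + 0 / c"
      by (rule LIMSEQ_le[OF tendsto_exp[OF tendsto_minus[OF lim]] tendsto_add[OF tendsto_const tendsto_divide[OF E_lim tendsto_const]]])
         (use lower e c in auto)
    ultimately show ?thesis by simp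
  qed
  \<comment> \<open>With this choice 2 e \<le> c/2, so all shifted gaps share the lower bound c/2
    needed for domination.\<close>
  define e where "e n = c / (4 * real (Suc n))" for n :: nat
  have e: "0 < e n" "2 * e n < c" "2 * e n \<le> c / 2" for n
  proof -
    have "c / (4 * real (Suc n)) \<le> c / 4" using c(1) by (intro divide_left_mono) auto
    then show "2 * e n < c" "2 * e n \<le> c / 2" using c(1) unfolding e_def by linarith+
    show "0 < e n" using c(1) by (simp add: e_def)
  qed
  have e_lim: "(\<lambda>n. b * e n) \<longlonglongrightarrow> 0" for b
    unfolding e_def by real_asymp
  \<comment> \<open>The values b = 2 and b = -2 serve the upper and the lower bound.\<close>
  have lim: "(\<lambda>n. gap_integral X (\<lambda>y. g y + b * e n)) \<longlonglongrightarrow> gap_integral X g" if b: "\<bar>b\<bar> = 2" for b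
  proof (rule gap_integral_tendsto[where d="c / 2"])
    show "AE y in lborel. (\<lambda>n. g y + b * e n) \<longlonglongrightarrow> g y"
      using tendsto_add[OF tendsto_const e_lim] by (intro AE_I2) simp
    show "c / 2 \<le> g y + b * e n" for n y
    proof -
      have "b = 2 \<or> b = - 2" using b by arith
      then have "- (2 * e n) \<le> b * e n" using e(1)[of n] by auto
      then show ?thesis using c(2)[of y] e(3)[of n] by linarith
    qed
    show "c / 2 \<le> g y" for y using c(1) c(2)[of y] by linarith
  qed (use c(1) in auto)
  have "?p \<le> exp (- gap_integral X g)"
    by (rule LIMSEQ_le_const[OF tendsto_exp[OF tendsto_minus[OF lim[of 2]]]]) (use bounds[OF e(1,2)] in auto)
  moreover have "exp (- gap_integral X g) \<le> ?p"
    by (rule LIMSEQ_le_const2[OF tendsto_exp[OF tendsto_minus[OF lim[of "- 2"]]]]) (use bounds[OF e(1,2)] in auto)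
  ultimately show ?thesis by simp
qed

text \<open>Enlarging g to \<open>G n\<close> only removes drops, which gives the upper bound for
  every n. The removed drops happen at levels with g < 1 / (n + 1), and their probability is at most
  twice the integral of 1 / g there, the vanishing tail of a convergent integral.\<close>

lemma prob_survive_le:
  assumes g[measurable]: "g \<in> borel_measurable borel" and pos: "\<And>y. 0 < g y" and X: "0 < X"
  shows "prob (space M - drops {0..<X} g) \<le> exp_neg (\<integral>\<^sup>+y\<in>{0..X}. ennreal (1 / g y) \<partial>lborel)"
    and "(\<integral>\<^sup>+y\<in>{0..X}. ennreal (1 / g y) \<partial>lborel) < \<infinity> \<Longrightarrow>
      exp_neg (\<integral>\<^sup>+y\<in>{0..X}. ennreal (1 / g y) \<partial>lborel) \<le> prob (space M - drops {0..<X} g)"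
proof -
  let ?p = "prob (space M - drops {0..<X} g)"
  let ?I = "\<integral>\<^sup>+y\<in>{0..X}. ennreal (1 / g y) \<partial>lborel"
  define G where "G n y = max (1 / real (Suc n)) (g y)" for n y
  have [measurable]: "G n \<in> borel_measurable borel" for n unfolding G_def by measurable
  have G: "1 / real (Suc n) \<le> G n y" "g y \<le> G n y" "0 < G n y" for n y
    using pos[of y] by (auto simp: G_def less_max_iff_disj)
  have sets: "drops E g \<in> sets M" "drops E (G n) \<in> sets M" if "E \<in> sets borel" for E n
    using that pos G(3) by (auto intro!: sets_drops)
  have p_G: "prob (space M - drops {0..<X} (G n)) = exp (- gap_integral X (G n))" for n
    by (rule prob_survive_bounded_below[OF _ _ G(1) X]) auto
  have p_le: "?p \<le> exp (- gap_integral X (G n))" for n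
    unfolding p_G[symmetric] using sets by (intro finite_measure_mono Diff_mono drops_mono G) auto
  have gap_nn: "(\<integral>\<^sup>+y\<in>{0..X}. ennreal (1 / G n y) \<partial>lborel) = ennreal (gap_integral X (G n))" for n
  proof -
    have "integrable lborel (\<lambda>y. indicator {0..X} y * (1 / G n y))"
    proof (rule integrable_indicator_bounded[where C="real (Suc n)"])
      show "\<bar>1 / G n y\<bar> \<le> real (Suc n)" for y
        using G(1)[of n y] G(3)[of n y] by (simp add: field_simps)
    qed simp
    then have "(\<integral>\<^sup>+y. ennreal (indicator {0..X} y * (1 / G n y)) \<partial>lborel) = ennreal (gap_integral X (G n))"
      unfolding gap_integral_def using less_imp_le[OF G(3)] by (intro nn_integral_eq_integral) (auto intro!: AE_I2)
    moreover have "ennreal (1 / G n y) * indicator {0..X} y = ennreal (indicator {0..X} y * (1 / G n y))" for y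
      by (auto simp: indicator_def)
    ultimately show ?thesis by simp
  qed
  have G_lim: "(\<lambda>n. G n y) \<longlonglongrightarrow> g y" for y
  proof -
    have "(\<lambda>n. max (1 / real (Suc n)) (g y)) \<longlonglongrightarrow> max 0 (g y)"
      by (intro tendsto_max tendsto_const LIMSEQ_Suc[OF lim_1_over_n])
    then show ?thesis using pos[of y] by (simp add: G_def max_def)
  qed
  have finite_case: "(\<lambda>n. gap_integral X (G n)) \<longlonglongrightarrow> enn2real ?I"
    "(\<lambda>n. \<integral>y. indicator {y\<in>{0..X}. g y < 1 / real (Suc n)} y * (1 / g y) \<partial>lborel) \<longlonglongrightarrow> 0"
    "integrable lborel (\<lambda>y. indicator {0..X} y * (1 / g y))"
    if fin: "?I < \<infinity>"
  proof -
    have I_eq: "?I = (\<integral>\<^sup>+y. ennreal (indicator {0..X} y * (1 / g y)) \<partial>lborel)"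
      by (intro nn_integral_cong) (auto simp: indicator_def)
    show int: "integrable lborel (\<lambda>y. indicator {0..X} y * (1 / g y))"
      using fin less_imp_le[OF pos] unfolding I_eq by (intro integrableI_nonneg) (auto intro!: AE_I2)
    have eq: "enn2real ?I = gap_integral X g"
      unfolding gap_integral_def I_eq
      by (rule integral_eq_nn_integral[symmetric]) (use less_imp_le[OF pos] in \<open>auto intro!: AE_I2\<close>)
    show "(\<lambda>n. gap_integral X (G n)) \<longlonglongrightarrow> enn2real ?I"
      unfolding eq unfolding gap_integral_def
    proof (rule integral_dominated_convergence[OF _ _ int])
      show "AE y in lborel. (\<lambda>n. indicator {0..X} y * (1 / G n y)) \<longlonglongrightarrow> indicator {0..X} y * (1 / g y)"
      proof (rule AE_I2)
        fix y show "(\<lambda>n. indicator {0..X} y * (1 / G n y)) \<longlonglongrightarrow> indicator {0..X} y * (1 / g y)"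
          using pos[of y] by (intro tendsto_intros G_lim) simp
      qed
      show "AE y in lborel. norm (indicator {0..X} y * (1 / G n y)) \<le> indicator {0..X} y * (1 / g y)" for n
      proof (rule AE_I2)
        fix y
        have "1 / G n y \<le> 1 / g y" using G(2)[of y n] G(3)[of n y] pos[of y] by (intro divide_left_mono) auto
        then show "norm (indicator {0..X} y * (1 / G n y)) \<le> indicator {0..X} y * (1 / g y)"
          using G(3)[of n y] by (auto simp: indicator_def)
      qed
    qed simp_all
    have "(\<lambda>n. \<integral>y. indicator {y\<in>{0..X}. g y < 1 / real (Suc n)} y * (1 / g y) \<partial>lborel) \<longlonglongrightarrow> (\<integral>y. 0 \<partial>(lborel :: real measure))"
    proof (rule integral_dominated_convergence[OF _ _ int])
      show "AE y in lborel. (\<lambda>n. indicator {y\<in>{0..X}. g y < 1 / real (Suc n)} y * (1 / g y)) \<longlonglongrightarrow> 0"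
      proof (rule AE_I2)
        fix y
        have "\<forall>\<^sub>F n in sequentially. 1 / real (Suc n) < g y"
          by (rule order_tendstoD(2)[OF LIMSEQ_Suc[OF lim_1_over_n] pos])
        then show "(\<lambda>n. indicator {y\<in>{0..X}. g y < 1 / real (Suc n)} y * (1 / g y)) \<longlonglongrightarrow> 0"
          by (intro tendsto_eventually) (auto elim!: eventually_mono)
      qed
      show "AE y in lborel. norm (indicator {y\<in>{0..X}. g y < 1 / real (Suc n)} y * (1 / g y)) \<le> indicator {0..X} y * (1 / g y)" for n
        using less_imp_le[OF pos] by (intro AE_I2) (auto simp: indicator_def)
    qed simp_all
    then show "(\<lambda>n. \<integral>y. indicator {y\<in>{0..X}. g y < 1 / real (Suc n)} y * (1 / g y) \<partial>lborel) \<longlonglongrightarrow> 0" by simp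
  qed
  show "?p \<le> exp_neg ?I"
  proof (cases "?I < \<infinity>")
    case True
    have "?p \<le> exp (- enn2real ?I)"
      by (rule LIMSEQ_le_const[OF tendsto_exp[OF tendsto_minus[OF finite_case(1)[OF True]]]]) (use p_le in auto)
    then show ?thesis by (simp only: exp_neg_finite[OF True])
  next
    case False
    have "?p = 0"
    proof (rule ccontr)
      assume "?p \<noteq> 0"
      then have p0: "0 < ?p" by (simp add: zero_less_measure_iff)
      \<comment> \<open>A positive survival probability would bound the truncated integrals
        uniformly, and by Fatou also the full integral, which is infinite.\<close>
      have "gap_integral X (G n) \<le> - ln ?p" for n
      proof -
        have "ln ?p \<le> ln (exp (- gap_integral X (G n)))" using p0 p_le by (intro ln_mono) auto
        then show ?thesis by simp
      qed
      then have le: "(\<integral>\<^sup>+y\<in>{0..X}. ennreal (1 / G n y) \<partial>lborel) \<le> ennreal (- ln ?p)" for n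
        unfolding gap_nn by (intro ennreal_leI)
      have "?I = (\<integral>\<^sup>+y. liminf (\<lambda>n. ennreal (1 / G n y) * indicator {0..X} y) \<partial>lborel)"
      proof (intro nn_integral_cong)
        fix y
        have "(\<lambda>n. ennreal (1 / G n y)) \<longlonglongrightarrow> ennreal (1 / g y)"
          using pos[of y] by (intro tendsto_ennrealI tendsto_intros G_lim) simp
        then have "(\<lambda>n. ennreal (1 / G n y) * indicator {0..X} y) \<longlonglongrightarrow> ennreal (1 / g y) * indicator {0..X} y"
          by (cases "y \<in> {0..X}") auto
        then show "ennreal (1 / g y) * indicator {0..X} y = liminf (\<lambda>n. ennreal (1 / G n y) * indicator {0..X} y)"
          by (intro lim_imp_Liminf[symmetric]) auto
      qed
      also have "\<dots> \<le> liminf (\<lambda>n. \<integral>\<^sup>+y\<in>{0..X}. ennreal (1 / G n y) \<partial>lborel)"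
        by (rule nn_integral_liminf) simp
      also have "\<dots> \<le> limsup (\<lambda>n. \<integral>\<^sup>+y\<in>{0..X}. ennreal (1 / G n y) \<partial>lborel)"
        by (rule Liminf_le_Limsup) simp
      also have "\<dots> \<le> ennreal (- ln ?p)"
        using le by (intro Limsup_bounded always_eventually) auto
      finally show False using False by (auto simp: less_top[symmetric] top_unique)
    qed
    moreover have "?I = \<infinity>" using False by (simp add: less_top[symmetric])
    ultimately show ?thesis by (simp only: exp_neg_infinity order_refl)
  qed
  show "exp_neg ?I \<le> ?p" if fin: "?I < \<infinity>"
  proof -
    define E where "E n = {y\<in>{0..X}. g y < 1 / real (Suc n)}" for n
    have [measurable]: "E n \<in> sets borel" for n unfolding E_def by measurable
    have "exp (- gap_integral X (G n)) \<le> ?p + 2 * (\<integral>y. indicator (E n) y * (1 / g y) \<partial>lborel)" for n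
    proof -
      have "prob (drops (E n) g) \<le> 2 * (\<integral>y. indicator (E n) y * (1 / g y) \<partial>lborel)"
      proof -
        have "emeasure M (drops (E n) g) \<le> 2 * (\<integral>\<^sup>+y\<in>E n. ennreal (1 / g y) \<partial>lborel)"
        proof (rule emeasure_drops_le)
          \<comment> \<open>The threshold 1 / (n + 1) never exceeds 1, as the dyadic layers
            require.\<close>
          show "0 < g y \<and> g y \<le> 1" if "y \<in> E n" for y
          proof -
            have "g y < 1 / real (Suc n)" using that by (simp add: E_def)
            also have "\<dots> \<le> 1" by simp
            finally show ?thesis using pos by simp
          qed
        qed (auto simp: E_def)
        also have "(\<integral>\<^sup>+y\<in>E n. ennreal (1 / g y) \<partial>lborel) = (\<integral>\<^sup>+y. ennreal (indicator (E n) y * (1 / g y)) \<partial>lborel)"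
          by (intro nn_integral_cong) (auto simp: indicator_def)
        also have "\<dots> = ennreal (\<integral>y. indicator (E n) y * (1 / g y) \<partial>lborel)"
        proof (rule nn_integral_eq_integral)
          show "integrable lborel (\<lambda>y. indicator (E n) y * (1 / g y))"
            by (rule Bochner_Integration.integrable_bound[OF finite_case(3)[OF fin]])
               (use less_imp_le[OF pos] in \<open>auto intro!: AE_I2 simp: E_def indicator_def\<close>)
        qed (use less_imp_le[OF pos] in \<open>auto intro!: AE_I2\<close>)
        finally have "ennreal (prob (drops (E n) g)) \<le> ennreal (2 * (\<integral>y. indicator (E n) y * (1 / g y) \<partial>lborel))"
          by (simp add: emeasure_eq_measure ennreal_mult' flip: ennreal_numeral)
        then show ?thesis using less_imp_le[OF pos] by (subst (asm) ennreal_le_iff) (auto intro!: Bochner_Integration.integral_nonneg)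
      qed
      moreover have "prob (space M - drops {0..<X} (G n)) \<le> ?p + prob (drops (E n) g)"
      proof (rule prob_compl_drops_le)
        show "drops {0..<X} g \<subseteq> drops {0..<X} (G n) \<union> drops (E n) g"
        proof
          fix \<omega> assume "\<omega> \<in> drops {0..<X} g"
          then obtain t where t: "\<omega> \<in> space M" "0 \<le> t" "running_sup B t \<omega> \<in> {0..<X}"
            "g (running_sup B t \<omega>) \<le> running_sup B t \<omega> - B t \<omega>" by (auto simp: drops_def)
          show "\<omega> \<in> drops {0..<X} (G n) \<union> drops (E n) g"
          proof (cases "running_sup B t \<omega> \<in> E n")
            case True
            then have "\<omega> \<in> drops (E n) g" using t unfolding drops_def by blast
            then show ?thesis ..
          next
            case False
            then have "G n (running_sup B t \<omega>) = g (running_sup B t \<omega>)" using t by (auto simp: E_def G_def)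
            then have "\<omega> \<in> drops {0..<X} (G n)" using t unfolding drops_def by (auto intro!: exI[of _ t])
            then show ?thesis ..
          qed
        qed
      qed (use sets in auto)
      ultimately show ?thesis unfolding p_G by simp
    qed
    then have "exp (- enn2real ?I) \<le> ?p + 2 * 0"
      by (intro LIMSEQ_le[OF tendsto_exp[OF tendsto_minus[OF finite_case(1)[OF fin]]]
            tendsto_add[OF tendsto_const tendsto_mult[OF tendsto_const finite_case(2)[OF fin]]]])
         (auto simp: E_def)
    then show ?thesis by (simp only: exp_neg_finite[OF fin] mult_zero_right add_0_right)
  qed
qed

end

section \<open>The drawdown time of a diffusion\<close>

text \<open>This is the substitution b = s(z), by which ds becomes Lebesgue measure on the natural
  scale; it suffices to compare masses of open intervals.\<close>

lemma distr_interval_measure: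
  fixes s :: "real \<Rightarrow> real"
  assumes s: "continuous_on UNIV s" "strict_mono s" "surj s"
  shows "distr (interval_measure s) borel s = lborel"
proof (rule lborel_eqI[symmetric])
  fix l u :: real assume "\<And>b. b \<in> Basis \<Longrightarrow> l \<bullet> b \<le> u \<bullet> b"
  then have lu: "l \<le> u" by simp
  have [measurable]: "s \<in> borel_measurable borel" using s(1) by (rule borel_measurable_continuous_onI)
  have mono: "s x \<le> s y \<longleftrightarrow> x \<le> y" "s x < s y \<longleftrightarrow> x < y" for x y
    using s(2) by (auto simp: strict_mono_less_eq strict_mono_less)
  have cont: "continuous (at_right a) s" for a
    using s(1) by (auto simp: continuous_on_eq_continuous_at intro: continuous_at_imp_continuous_within)
  obtain a b where ab: "l = s a" "u = s b" using s(3) by (metis surjD)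
  have "a \<le> b" using lu by (simp add: ab mono)
  have "emeasure (distr (interval_measure s) borel s) (box l u) = emeasure (interval_measure s) (s -` {l<..<u})"
    by (subst emeasure_distr) (auto simp: box_real)
  \<comment> \<open>The Stieltjes mass is known on half-open intervals. The surplus endpoint b is
    null since s is continuous.\<close>
  also have "s -` {l<..<u} = {a<..b} - {b..b}" by (auto simp: ab mono)
  also have "emeasure (interval_measure s) \<dots> = emeasure (interval_measure s) {a<..b}"
  proof (rule emeasure_Diff_null_set)
    have "emeasure (interval_measure s) {b..b} = 0"
      using emeasure_interval_measure_Icc[of b b s] s(1) by (simp add: mono)
    then show "{b..b} \<in> null_sets (interval_measure s)" by (auto intro: null_setsI)
  qed simp
  also have "\<dots> = ennreal (s b - s a)"
    using \<open>a \<le> b\<close> cont by (intro emeasure_interval_measure_Ioc) (auto simp: mono)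
  finally show "emeasure (distr (interval_measure s) borel s) (box l u) = ennreal (\<Prod>b\<in>Basis. (u - l) \<bullet> b)"
    by (simp add: ab)
qed simp

lemma scale_integral_le_mono: "x \<le> y \<Longrightarrow> scale_integral s \<theta> x \<le> scale_integral s \<theta> y"
  unfolding scale_integral_def by (intro nn_integral_mono) (auto simp: indicator_def)

lemma harmonic_step:
  fixes x y :: real
  assumes "x < y"
  shows "x < x + (y - x) / real (Suc n)" and "x + (y - x) / real (Suc n) \<le> y"
proof -
  have "(y - x) / real (Suc n) \<le> (y - x) / 1" using assms by (intro divide_left_mono) auto
  then show "x + (y - x) / real (Suc n) \<le> y" by simp
qed (use assms in simp)

text \<open>Continuity from above of the measure with density 1 / (s z - s (z - \<theta> z)) along
  shrinking intervals, for which finiteness at y is essential. It lets levels u > x descend to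
  x.\<close>

lemma scale_integral_right_continuous:
  assumes [measurable]: "s \<in> borel_measurable borel" "\<theta> \<in> borel_measurable borel"
    and xy: "x < y" and fin: "scale_integral s \<theta> y < \<infinity>"
  shows "(\<lambda>n. scale_integral s \<theta> (x + (y - x) / real (Suc n))) \<longlonglongrightarrow> scale_integral s \<theta> x"
proof -
  define \<nu> where "\<nu> = density (interval_measure s) (\<lambda>z. ennreal (1 / (s z - s (z - \<theta> z))))"
  have \<nu>: "scale_integral s \<theta> z = emeasure \<nu> {0<..z}" for z
    unfolding \<nu>_def scale_integral_def by (subst emeasure_density) auto
  define u where "u n = x + (y - x) / real (Suc n)" for n :: nat
  have u: "x < u n" "u n \<le> y" for n unfolding u_def by (rule harmonic_step[OF xy])+
  have dec: "decseq u" using xy by (auto simp: decseq_def u_def intro!: divide_left_mono)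
  have lim: "u \<longlonglongrightarrow> x"
  proof -
    have "(\<lambda>n. x + (y - x) / real (Suc n)) \<longlonglongrightarrow> x + 0"
      by (intro tendsto_add tendsto_const LIMSEQ_Suc[OF lim_const_over_n])
    then show ?thesis by (simp add: u_def[abs_def])
  qed
  have "(\<lambda>n. emeasure \<nu> {0<..u n}) \<longlonglongrightarrow> emeasure \<nu> (\<Inter>n. {0<..u n})"
  proof (rule Lim_emeasure_decseq)
    show "decseq (\<lambda>n. {0<..u n})" by (auto simp: decseq_def intro: order_trans[OF _ decseqD[OF dec]])
    show "emeasure \<nu> {0<..u n} \<noteq> \<infinity>" for n
      using scale_integral_le_mono[OF u(2), of s \<theta> n] fin unfolding \<nu> by auto
  qed (auto simp: \<nu>_def)
  also have "(\<Inter>n. {0<..u n}) = {0<..x}"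
  proof (intro set_eqI iffI)
    fix z assume "z \<in> (\<Inter>n. {0<..u n})"
    then have "0 < z" "\<And>n. z \<le> u n" by auto
    moreover from this(2) have "z \<le> x" by (intro LIMSEQ_le_const[OF lim]) auto
    ultimately show "z \<in> {0<..x}" by simp
  qed (use u(1) in \<open>auto intro: order_trans less_imp_le\<close>)
  finally show ?thesis by (simp add: \<nu> u_def)
qed

text \<open>The increment s z - s (z - a) is continuous and positive, hence bounded below on [0, x].
  This makes the constant-threshold formula unconditional.\<close>

lemma scale_integral_const_finite:
  assumes s: "continuous_on UNIV s" "strict_mono s" and a: "0 < a"
  shows "scale_integral s (\<lambda>_. a) x < \<infinity>"
proof (cases "0 < x")
  case True
  have mono: "s x \<le> s y \<longleftrightarrow> x \<le> y" "s x < s y \<longleftrightarrow> x < y" for x y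
    using s(2) by (auto simp: strict_mono_less_eq strict_mono_less)
  have cont: "continuous_on {0..x} (\<lambda>z. s z - s (z - a))"
    by (intro continuous_intros continuous_on_compose2[OF s(1)]) auto
  obtain z0 where z0: "\<And>z. z \<in> {0..x} \<Longrightarrow> s z0 - s (z0 - a) \<le> s z - s (z - a)"
    using continuous_attains_inf[OF compact_Icc _ cont] True by fastforce
  define m where "m = s z0 - s (z0 - a)"
  have m: "0 < m" using a by (simp add: m_def mono)
  have right: "continuous (at_right a) s" for a
    using s(1) by (auto simp: continuous_on_eq_continuous_at intro: continuous_at_imp_continuous_within)
  have "scale_integral s (\<lambda>_. a) x \<le> (\<integral>\<^sup>+z\<in>{0<..x}. ennreal (1 / m) \<partial>interval_measure s)"
    unfolding scale_integral_def
  proof (rule nn_integral_mono)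
    fix z
    show "ennreal (1 / (s z - s (z - a))) * indicator {0<..x} z \<le> ennreal (1 / m) * indicator {0<..x} z"
    proof (cases "z \<in> {0<..x}")
      case True
      then have "m \<le> s z - s (z - a)" using z0[of z] by (simp add: m_def)
      then have "1 / (s z - s (z - a)) \<le> 1 / m" using m by (intro divide_left_mono) auto
      then show ?thesis by (intro mult_right_mono ennreal_leI) auto
    qed simp
  qed
  also have "\<dots> = ennreal (1 / m) * ennreal (s x - s 0)"
    using True right by (simp add: nn_integral_cmult_indicator emeasure_interval_measure_Ioc mono)
  also have "\<dots> < \<infinity>" by (simp add: ennreal_mult_less_top)
  finally show ?thesis .
qed (simp add: scale_integral_def)

section \<open>Drawdown times and their transfer to the natural scale\<close>

lemma drawdown_time_real:
  assumes "t \<in> {t. 0 \<le> t \<and> running_sup Y t \<omega> - Y t \<omega> \<ge> \<theta> (running_sup Y t \<omega>)}" (is "t \<in> ?A")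
  shows "drawdown_time Y \<theta> \<omega> = ereal (Inf ?A)"
  unfolding drawdown_time_def
  by (rule ereal_Inf'[symmetric]) (use assms in \<open>auto intro!: bdd_belowI[of _ 0]\<close>)

lemma drawdown_time_empty:
  assumes "{t. 0 \<le> t \<and> running_sup Y t \<omega> - Y t \<omega> \<ge> \<theta> (running_sup Y t \<omega>)} = {}"
  shows "drawdown_time Y \<theta> \<omega> = \<infinity>"
  unfolding drawdown_time_def assms by (simp add: top_ereal_def)

text \<open>Positivity of \<open>\<theta>\<close> includes the level 0, where the supremum starts;
  if \<open>\<theta> 0\<close> is not positive, \<open>T\<close> is 0, a case the theorem treats
  separately.\<close>

locale drawdown = filtered_prob_space M F for M :: "'a measure" and F +
  fixes Y :: "real \<Rightarrow> 'a \<Rightarrow> real" and s \<theta> :: "real \<Rightarrow> real"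
  assumes Y_paths: "continuous_paths M Y" and Y_recurrent: "recurrent M Y"
    and Y_0: "\<And>\<omega>. \<omega> \<in> space M \<Longrightarrow> Y 0 \<omega> = 0"
    and s_cont: "continuous_on UNIV s" and s_strict: "strict_mono s" and s_0: "s 0 = 0"
    and s_top: "filterlim s at_top at_top" and s_bot: "filterlim s at_bot at_bot"
    and s_Y: "continuous_local_martingale M F (\<lambda>t \<omega>. s (Y t \<omega>))"
    and \<theta>_borel: "\<theta> \<in> borel_measurable borel" and \<theta>_pos: "\<And>x. 0 \<le> x \<Longrightarrow> 0 < \<theta> x"
    and T_finite: "AE \<omega> in M. drawdown_time Y \<theta> \<omega> < \<infinity>"
begin

sublocale unbounded_local_martingale M F "\<lambda>t \<omega>. s (Y t \<omega>)"
proof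
  show "adapted F (\<lambda>t \<omega>. s (Y t \<omega>))" "continuous_paths M (\<lambda>t \<omega>. s (Y t \<omega>))"
    "continuous_local_martingale M F (\<lambda>t \<omega>. s (Y t \<omega>))"
    using s_Y by (auto simp: continuous_local_martingale_def)
  show "s (Y 0 \<omega>) = 0" if "\<omega> \<in> space M" for \<omega> using Y_0[OF that] s_0 by simp
  show "AE \<omega> in M. \<exists>t\<ge>0. y \<le> s (Y t \<omega>)" for y
  proof -
    obtain x where "y \<le> s x" using s_top unfolding filterlim_at_top eventually_at_top_linorder by blast
    moreover have "AE \<omega> in M. \<forall>t\<ge>0. \<exists>u\<ge>t. Y u \<omega> = x" using Y_recurrent by (auto simp: recurrent_def)
    ultimately show ?thesis by (auto elim!: eventually_mono)
  qed
qed

lemma s_le: "s x \<le> s y \<longleftrightarrow> x \<le> y" and s_less: "s x < s y \<longleftrightarrow> x < y"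
  using s_strict by (auto simp: strict_mono_less_eq strict_mono_less)

lemma surj_s: "surj s"
  unfolding surj_def
proof
  fix y
  obtain l where l: "s l \<le> y" using s_bot unfolding filterlim_at_bot eventually_at_bot_linorder by blast
  obtain u where u: "y \<le> s u" using s_top unfolding filterlim_at_top eventually_at_top_linorder by blast
  have "l \<le> u" using l u s_le order_trans by blast
  then show "\<exists>x. y = s x" using IVT'[of s l y u] l u continuous_on_subset[OF s_cont] by auto
qed

definition r :: "real \<Rightarrow> real" where "r = inv s"

lemma s_r [simp]: "s (r y) = y" and r_s [simp]: "r (s x) = x"
  using surj_s strict_mono_imp_inj_on[OF s_strict] by (simp_all add: r_def surj_f_inv_f)

lemma measurable_s [measurable]: "s \<in> borel_measurable borel"
  using s_cont by (rule borel_measurable_continuous_onI)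

lemma measurable_r [measurable]: "r \<in> borel_measurable borel"
proof (rule borel_measurable_mono)
  show "mono r" by (rule monoI) (metis s_le s_r)
qed

lemma measurable_\<theta> [measurable]: "\<theta> \<in> borel_measurable borel"
  by (rule \<theta>_borel)

lemma Y_path: "\<omega> \<in> space M \<Longrightarrow> continuous_on {0..} (\<lambda>t. Y t \<omega>)"
  using Y_paths by (auto simp: continuous_paths_def)

lemma running_sup_s:
  assumes "\<omega> \<in> space M" "0 \<le> t"
  shows "running_sup (\<lambda>t \<omega>. s (Y t \<omega>)) t \<omega> = s (running_sup Y t \<omega>)"
  by (rule running_sup_compose[where Y=Y, OF Y_path[OF assms(1)] strict_mono_mono[OF s_strict] s_cont assms(2)])

lemma running_sup_Y_nonneg:
  assumes "\<omega> \<in> space M" "0 \<le> t"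
  shows "0 \<le> running_sup Y t \<omega>"
  using le_running_sup[where B=Y, OF Y_path[OF assms(1)], of 0 t] Y_0[OF assms(1)] assms(2) by simp

text \<open>The threshold transported by s: at level z = r y, a fall of Y to z - \<theta> z is a
  fall of s(Y) to s (z - \<theta> z). The value 1 at negative levels, which the supremum never
  takes, keeps the function positive and Borel everywhere.\<close>

definition gap :: "real \<Rightarrow> real" where
  "gap y = (if 0 \<le> y then y - s (r y - \<theta> (r y)) else 1)"

lemma gap_pos: "0 < gap y"
proof (cases "0 \<le> y")
  case True
  then have "0 \<le> r y" using s_le[of 0 "r y"] s_0 by simp
  then have "r y - \<theta> (r y) < r y" using \<theta>_pos by simp
  then have "s (r y - \<theta> (r y)) < s (r y)" by (simp only: s_less)
  then show ?thesis using True by (simp add: gap_def)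
qed (simp add: gap_def)

lemma measurable_gap [measurable]: "gap \<in> borel_measurable borel"
  unfolding gap_def[abs_def] by measurable

lemma scale_integral_eq:
  assumes "0 \<le> x"
  shows "scale_integral s \<theta> x = (\<integral>\<^sup>+y\<in>{0..s x}. ennreal (1 / gap y) \<partial>lborel)"
proof -
  \<comment> \<open>The scale integral omits the left endpoint; it has Lebesgue measure 0.\<close>
  have "(\<integral>\<^sup>+y\<in>{0..s x}. ennreal (1 / gap y) \<partial>lborel) = (\<integral>\<^sup>+y\<in>{0<..s x}. ennreal (1 / gap y) \<partial>lborel)"
  proof (rule nn_integral_cong_AE)
    show "AE y in lborel. ennreal (1 / gap y) * indicator {0..s x} y = ennreal (1 / gap y) * indicator {0<..s x} y"
      using AE_lborel_singleton[of 0] by eventually_elim (auto simp: indicator_def)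
  qed
  also have "\<dots> = (\<integral>\<^sup>+z. ennreal (1 / gap (s z)) * indicator {0<..s x} (s z) \<partial>interval_measure s)"
    by (subst distr_interval_measure[OF s_cont s_strict surj_s, symmetric], subst nn_integral_distr) auto
  also have "\<dots> = scale_integral s \<theta> x"
    unfolding scale_integral_def
  proof (rule nn_integral_cong)
    fix z
    have "s z \<in> {0<..s x} \<longleftrightarrow> z \<in> {0<..x}" using s_less[of 0 z] by (simp add: s_le s_0)
    moreover have "gap (s z) = s z - s (z - \<theta> z)" if "0 < z"
      using that s_less[of 0 z] by (simp add: gap_def s_0)
    ultimately show "ennreal (1 / gap (s z)) * indicator {0<..s x} (s z) = ennreal (1 / (s z - s (z - \<theta> z))) * indicator {0<..x} z"
      by (cases "z \<in> {0<..x}") (simp_all add: indicator_def)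
  qed
  finally show ?thesis by simp
qed

definition triggers :: "'a \<Rightarrow> real set" where
  "triggers \<omega> = {t. 0 \<le> t \<and> running_sup Y t \<omega> - Y t \<omega> \<ge> \<theta> (running_sup Y t \<omega>)}"

lemma drops_gap_eq: "drops {0..<s x} gap = {\<omega>\<in>space M. \<exists>t\<in>triggers \<omega>. running_sup Y t \<omega> < x}"
proof -
  have "running_sup (\<lambda>t \<omega>. s (Y t \<omega>)) t \<omega> \<in> {0..<s x} \<and>
      gap (running_sup (\<lambda>t \<omega>. s (Y t \<omega>)) t \<omega>) \<le> running_sup (\<lambda>t \<omega>. s (Y t \<omega>)) t \<omega> - s (Y t \<omega>)
    \<longleftrightarrow> t \<in> triggers \<omega> \<and> running_sup Y t \<omega> < x"
    if \<omega>: "\<omega> \<in> space M" and t: "0 \<le> t" for \<omega> t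
  proof -
    have pos: "0 \<le> s (running_sup Y t \<omega>)" using running_sup_Y_nonneg[OF \<omega> t] s_le[of 0] s_0 by simp
    then have "gap (s (running_sup Y t \<omega>)) = s (running_sup Y t \<omega>) - s (running_sup Y t \<omega> - \<theta> (running_sup Y t \<omega>))"
      by (simp add: gap_def)
    then have "gap (s (running_sup Y t \<omega>)) \<le> s (running_sup Y t \<omega>) - s (Y t \<omega>)
      \<longleftrightarrow> s (Y t \<omega>) \<le> s (running_sup Y t \<omega> - \<theta> (running_sup Y t \<omega>))" by auto
    also have "\<dots> \<longleftrightarrow> t \<in> triggers \<omega>" using t unfolding s_le by (auto simp: triggers_def)
    finally show ?thesis unfolding running_sup_s[OF \<omega> t] using pos by (auto simp: s_less)
  qed
  then show ?thesis unfolding drops_def by (auto simp: triggers_def)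
qed

lemma sets_drops_gap: "drops {0..<s x} gap \<in> sets M"
  using gap_pos by (intro sets_drops) auto

text \<open>\<open>real_of_ereal\<close> sends infinity to 0, so on the null set without triggers
  this is the supremum at time 0, namely 0.\<close>

abbreviation sup_at_T :: "'a \<Rightarrow> real" where
  "sup_at_T \<omega> \<equiv> running_sup Y (real_of_ereal (drawdown_time Y \<theta> \<omega>)) \<omega>"

lemma sup_at_T_le:
  assumes \<omega>: "\<omega> \<in> space M" and t: "t \<in> triggers \<omega>"
  shows "sup_at_T \<omega> \<le> running_sup Y t \<omega>"
proof -
  have "drawdown_time Y \<theta> \<omega> = ereal (Inf (triggers \<omega>))"
    using drawdown_time_real[where t=t and Y=Y and \<omega>=\<omega> and \<theta>=\<theta>] t by (simp add: triggers_def)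
  moreover have "0 \<le> Inf (triggers \<omega>)" by (rule cInf_greatest) (use t in \<open>auto simp: triggers_def\<close>)
  moreover have "Inf (triggers \<omega>) \<le> t" by (rule cInf_lower[OF t]) (auto simp: triggers_def intro!: bdd_belowI[of _ 0])
  ultimately show ?thesis using running_sup_mono[where B=Y, OF Y_path[OF \<omega>]] by simp
qed

text \<open>The infimum of the triggers may fail to be a trigger, but triggers approach it and the
  running supremum is continuous. Only a weak inequality survives this limit.\<close>

lemma le_sup_at_T:
  assumes \<omega>: "\<omega> \<in> space M" and ne: "triggers \<omega> \<noteq> {}" and ge: "\<And>t. t \<in> triggers \<omega> \<Longrightarrow> x \<le> running_sup Y t \<omega>"
  shows "x \<le> sup_at_T \<omega>"
proof (rule ccontr)
  define \<tau> where "\<tau> = Inf (triggers \<omega>)"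
  have \<tau>0: "0 \<le> \<tau>" unfolding \<tau>_def by (rule cInf_greatest[OF ne]) (auto simp: triggers_def)
  have T: "drawdown_time Y \<theta> \<omega> = ereal \<tau>"
    using drawdown_time_real[where Y=Y and \<omega>=\<omega> and \<theta>=\<theta>] ne by (auto simp: triggers_def \<tau>_def)
  assume "\<not> x \<le> sup_at_T \<omega>"
  then have less: "running_sup Y \<tau> \<omega> < x" by (simp add: T)
  obtain d where d: "0 < d" "\<And>t. 0 \<le> t \<Longrightarrow> \<bar>t - \<tau>\<bar> < d \<Longrightarrow> \<bar>running_sup Y t \<omega> - running_sup Y \<tau> \<omega>\<bar> < x - running_sup Y \<tau> \<omega>"
    using running_sup_continuous[where B=Y, OF Y_path[OF \<omega>]] \<tau>0 less unfolding continuous_on_iff dist_real_def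
    by (metis atLeast_iff diff_gt_0_iff_gt)
  obtain t where t: "t \<in> triggers \<omega>" "t < \<tau> + d"
    using cInf_lessD[OF ne, of "\<tau> + d"] d(1) by (auto simp: \<tau>_def)
  have "\<tau> \<le> t" unfolding \<tau>_def by (rule cInf_lower[OF t(1)]) (auto simp: triggers_def intro!: bdd_belowI[of _ 0])
  then have "\<bar>running_sup Y t \<omega> - running_sup Y \<tau> \<omega>\<bar> < x - running_sup Y \<tau> \<omega>"
    using t(2) \<tau>0 by (intro d(2)) auto
  then show False using ge[OF t(1)] by linarith
qed

lemma AE_triggers: "AE \<omega> in M. triggers \<omega> \<noteq> {}"
  using T_finite
proof eventually_elim
  fix \<omega> assume "drawdown_time Y \<theta> \<omega> < \<infinity>"
  then show "triggers \<omega> \<noteq> {}" using drawdown_time_empty[where Y=Y and \<omega>=\<omega> and \<theta>=\<theta>] by (auto simp: triggers_def)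
qed

lemma sets_triggers: "{\<omega>\<in>space M. triggers \<omega> \<noteq> {}} \<in> sets M"
proof -
  have "{\<omega>\<in>space M. triggers \<omega> \<noteq> {}} = (\<Union>n::nat. drops {0..<s (real n)} gap)"
    unfolding drops_gap_eq using reals_Archimedean2 by (auto; blast)
  then show ?thesis using sets_drops_gap by auto
qed

text \<open>Measurability of \<open>T\<close> is avoided: exceeding x strictly means that some
  trigger exists and that, for some n, none occurs below level x + 1 / (n + 1).\<close>

lemma sets_sup_at_T:
  assumes x: "0 \<le> x"
  shows "{\<omega>\<in>space M. sup_at_T \<omega> > x} \<in> sets M"
proof -
  have "{\<omega>\<in>space M. sup_at_T \<omega> > x} = {\<omega>\<in>space M. triggers \<omega> \<noteq> {}} \<inter>
      (\<Union>n::nat. space M - drops {0..<s (x + 1 / real (Suc n))} gap)" (is "?l = ?r")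
  proof (intro set_eqI iffI)
    fix \<omega> assume "\<omega> \<in> ?l"
    then have \<omega>: "\<omega> \<in> space M" and less: "x < sup_at_T \<omega>" by auto
    \<comment> \<open>Without triggers the default value 0 cannot exceed x \<ge> 0.\<close>
    have ne: "triggers \<omega> \<noteq> {}"
    proof
      assume "triggers \<omega> = {}"
      then have "drawdown_time Y \<theta> \<omega> = \<infinity>" by (intro drawdown_time_empty) (simp add: triggers_def)
      moreover have "running_sup Y 0 \<omega> = 0" by (simp add: running_sup_def Y_0[OF \<omega>])
      ultimately show False using less x by simp
    qed
    obtain n :: nat where "1 / real (Suc n) < sup_at_T \<omega> - x"
      using nat_approx_posE[of "sup_at_T \<omega> - x"] less by auto
    then have "\<omega> \<notin> drops {0..<s (x + 1 / real (Suc n))} gap"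
      using sup_at_T_le[OF \<omega>] unfolding drops_gap_eq by fastforce
    then show "\<omega> \<in> ?r" using \<omega> ne by blast
  next
    fix \<omega> assume "\<omega> \<in> ?r"
    then obtain n :: nat where \<omega>: "\<omega> \<in> space M" "triggers \<omega> \<noteq> {}" "\<omega> \<notin> drops {0..<s (x + 1 / real (Suc n))} gap" by blast
    then have "x + 1 / real (Suc n) \<le> sup_at_T \<omega>"
      by (intro le_sup_at_T) (auto simp: drops_gap_eq not_less)
    moreover have "0 < 1 / real (Suc n)" by simp
    ultimately have "x < sup_at_T \<omega>" by linarith
    then show "\<omega> \<in> ?l" using \<omega>(1) by simp
  qed
  also have "\<dots> \<in> sets M" using sets_triggers sets_drops_gap by auto
  finally show ?thesis .
qed

text \<open>A trigger at a supremum below x forces the supremum at \<open>T\<close> below x, so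
  exceeding x entails surviving all levels below x.\<close>

lemma prob_sup_at_T_le:
  assumes x: "0 \<le> x"
  shows "prob {\<omega>\<in>space M. sup_at_T \<omega> > x} \<le> exp_neg (scale_integral s \<theta> x)"
proof (cases "x = 0")
  case True
  then show ?thesis by (simp add: scale_integral_def exp_neg_def)
next
  case False
  then have sx: "0 < s x" using x s_less[of 0 x] s_0 by simp
  have "prob {\<omega>\<in>space M. sup_at_T \<omega> > x} \<le> prob (space M - drops {0..<s x} gap)"
    using sup_at_T_le sets_drops_gap
    by (intro finite_measure_mono) (fastforce simp: drops_gap_eq)+
  also have "\<dots> \<le> exp_neg (scale_integral s \<theta> x)"
    unfolding scale_integral_eq[OF x] using gap_pos sx by (intro prob_survive_le) auto
  finally show ?thesis .
qed

text \<open>Surviving up to u > x gives a supremum of at least u at \<open>T\<close>, hence strictly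
  above x; surviving up to x alone would not. Right-continuity then removes the excess, which is
  where finiteness beyond x enters.\<close>

lemma le_prob_sup_at_T:
  assumes x: "0 \<le> x" "x < y" and fin: "scale_integral s \<theta> y < \<infinity>"
  shows "exp_neg (scale_integral s \<theta> x) \<le> prob {\<omega>\<in>space M. sup_at_T \<omega> > x}"
proof -
  define u where "u n = x + (y - x) / real (Suc n)" for n :: nat
  have u: "x < u n" "u n \<le> y" for n unfolding u_def by (rule harmonic_step[OF x(2)])+
  have fin_u: "scale_integral s \<theta> z < \<infinity>" if "z \<le> y" for z
    using scale_integral_le_mono[OF that, of s \<theta>] fin by (rule le_less_trans)
  have le: "exp (- enn2real (scale_integral s \<theta> (u n))) \<le> prob {\<omega>\<in>space M. sup_at_T \<omega> > x}" for n
  proof -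
    have un: "0 \<le> u n" using u(1)[of n] x by simp
    have su: "0 < s (u n)" using u(1)[of n] x s_less[of 0 "u n"] s_0 by simp
    have "exp (- enn2real (scale_integral s \<theta> (u n))) = exp_neg (scale_integral s \<theta> (u n))"
      by (simp only: exp_neg_finite[OF fin_u[OF u(2)]])
    also have "\<dots> \<le> prob (space M - drops {0..<s (u n)} gap)"
      using fin_u[OF u(2)[of n]] unfolding scale_integral_eq[OF un]
      by (intro prob_survive_le gap_pos su) auto
    also have "\<dots> \<le> prob {\<omega>\<in>space M. sup_at_T \<omega> > x}"
    proof (rule finite_measure_mono_AE)
      show "AE \<omega> in M. \<omega> \<in> space M - drops {0..<s (u n)} gap \<longrightarrow> \<omega> \<in> {\<omega>\<in>space M. sup_at_T \<omega> > x}"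
        using AE_triggers
      proof eventually_elim
        fix \<omega> assume ne: "triggers \<omega> \<noteq> {}"
        show "\<omega> \<in> space M - drops {0..<s (u n)} gap \<longrightarrow> \<omega> \<in> {\<omega>\<in>space M. sup_at_T \<omega> > x}"
        proof
          assume *: "\<omega> \<in> space M - drops {0..<s (u n)} gap"
          then have "u n \<le> sup_at_T \<omega>"
            using ne by (intro le_sup_at_T) (auto simp: drops_gap_eq not_less)
          then show "\<omega> \<in> {\<omega>\<in>space M. sup_at_T \<omega> > x}" using * u(1)[of n] by auto
        qed
      qed
    qed (use sets_sup_at_T x in auto)
    finally show ?thesis .
  qed
  have fin_x: "scale_integral s \<theta> x < \<infinity>" using fin_u x by simp
  have "(\<lambda>n. exp (- enn2real (scale_integral s \<theta> (u n)))) \<longlonglongrightarrow> exp (- enn2real (scale_integral s \<theta> x))"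
    using scale_integral_right_continuous[OF measurable_s \<theta>_borel x(2) fin] fin_x
    by (intro tendsto_intros tendsto_enn2real) (auto simp: u_def less_top)
  then have "exp (- enn2real (scale_integral s \<theta> x)) \<le> prob {\<omega>\<in>space M. sup_at_T \<omega> > x}"
    by (rule LIMSEQ_le_const2) (use le in auto)
  then show ?thesis by (simp only: exp_neg_finite[OF fin_x])
qed

end

text \<open>The side condition excludes real failures of the formula. If the integral is finite at x
  but infinite at every y > x, then with \<theta> 0 > 0 the probability is 0, being a limit of
  probabilities bounded by \<open>exp_neg\<close> of infinity, while the right side is positive. If
  \<theta> 0 \<le> 0, then \<open>T\<close> is 0 and the formula needs an infinite integral.\<close>

theorem proposition4p11:
  fixes M :: "'a measure" and F :: "real \<Rightarrow> 'a measure"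
    and Y :: "real \<Rightarrow> 'a \<Rightarrow> real" and s \<theta> :: "real \<Rightarrow> real" and T :: "'a \<Rightarrow> ereal"
  assumes "filtered_prob_space M F"
    and "diffusion M F Y" and "recurrent M Y"
    and "\<forall>\<omega>\<in>space M. Y 0 \<omega> = 0"
    and "continuous_on UNIV s" and "strict_mono s" and "s 0 = 0"
    and "filterlim s at_top at_top" and "filterlim s at_bot at_bot"
    and "continuous_local_martingale M F (\<lambda>t \<omega>. s (Y t \<omega>))"
    and "\<theta> \<in> borel_measurable borel" and "\<forall>x>0. \<theta> x > 0"
    and "\<forall>\<omega>\<in>space M. T \<omega> = drawdown_time Y \<theta> \<omega>"
    and "AE \<omega> in M. T \<omega> < \<infinity>"
  shows "(\<forall>x\<ge>0.
            scale_integral s \<theta> x = \<infinity> \<or> (\<theta> 0 > 0 \<and> (\<exists>y>x. scale_integral s \<theta> y < \<infinity>)) \<longrightarrow>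
            measure M {\<omega>\<in>space M. running_sup Y (real_of_ereal (T \<omega>)) \<omega> > x}
              = exp_neg (scale_integral s \<theta> x))
       \<and> (\<forall>a>0. (\<forall>x. \<theta> x = a) \<longrightarrow>
            (\<forall>x\<ge>0. measure M {\<omega>\<in>space M. running_sup Y (real_of_ereal (T \<omega>)) \<omega> > x}
              = exp_neg (scale_integral s (\<lambda>_. a) x)))"
proof -
  have event: "{\<omega>\<in>space M. running_sup Y (real_of_ereal (T \<omega>)) \<omega> > x}
      = {\<omega>\<in>space M. running_sup Y (real_of_ereal (drawdown_time Y \<theta> \<omega>)) \<omega> > x}" for x
    using assms(13) by auto
  have positive: "drawdown M F Y s \<theta>" if "0 < \<theta> 0"
  proof -
    interpret filtered_prob_space M F by (rule assms(1))
    show ?thesis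
    proof
      show "continuous_paths M Y" using assms(2) by (simp add: diffusion_def)
      show "0 < \<theta> x" if "0 \<le> x" for x using that \<open>0 < \<theta> 0\<close> assms(12) by (cases "x = 0") auto
      show "AE \<omega> in M. drawdown_time Y \<theta> \<omega> < \<infinity>"
        using assms(14) by (rule AE_mp) (use assms(13) in auto)
    qed (use assms in auto)
  qed
  have main: "measure M {\<omega>\<in>space M. running_sup Y (real_of_ereal (T \<omega>)) \<omega> > x} = exp_neg (scale_integral s \<theta> x)"
    if x: "0 \<le> x" and cond: "scale_integral s \<theta> x = \<infinity> \<or> (\<theta> 0 > 0 \<and> (\<exists>y>x. scale_integral s \<theta> y < \<infinity>))" for x
  proof (cases "0 < \<theta> 0")
    case True
    interpret drawdown M F Y s \<theta> by (rule positive[OF True])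
    show ?thesis
    proof (cases "scale_integral s \<theta> x = \<infinity>")
      case True
      have "measure M {\<omega>\<in>space M. sup_at_T \<omega> > x} \<le> 0"
        using prob_sup_at_T_le[OF x] by (simp only: True exp_neg_infinity)
      then show ?thesis unfolding event True exp_neg_infinity by (simp add: measure_le_0_iff)
    next
      case False
      then obtain y where "x < y" "scale_integral s \<theta> y < \<infinity>" using cond by blast
      then show ?thesis
        unfolding event using prob_sup_at_T_le[OF x] le_prob_sup_at_T[OF x] by (intro antisym) auto
    qed
  next
    case False
    \<comment> \<open>Time 0 is already a trigger, so the event is empty; the side condition leaves
      only an infinite integral, and both sides are 0.\<close>
    have "running_sup Y (real_of_ereal (drawdown_time Y \<theta> \<omega>)) \<omega> = 0" if \<omega>: "\<omega> \<in> space M" for \<omega>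
    proof -
      let ?A = "{t. 0 \<le> t \<and> running_sup Y t \<omega> - Y t \<omega> \<ge> \<theta> (running_sup Y t \<omega>)}"
      have 0: "running_sup Y 0 \<omega> = 0" "Y 0 \<omega> = 0" using assms(4) \<omega> by (simp_all add: running_sup_def)
      then have A: "0 \<in> ?A" using False by simp
      have "drawdown_time Y \<theta> \<omega> = ereal (Inf ?A)" by (rule drawdown_time_real[OF A])
      moreover have "Inf ?A = 0" by (rule cInf_eq_minimum[OF A]) simp
      ultimately have "drawdown_time Y \<theta> \<omega> = 0" by (simp add: zero_ereal_def)
      then show ?thesis using 0 by simp
    qed
    then have "{\<omega>\<in>space M. running_sup Y (real_of_ereal (T \<omega>)) \<omega> > x} = {}" unfolding event using x by auto
    moreover have "scale_integral s \<theta> x = \<infinity>" using cond False by blast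
    ultimately show ?thesis by (simp only: exp_neg_infinity measure_empty)
  qed
  show ?thesis
  proof (intro conjI allI impI)
    fix a x :: real assume a: "0 < a" "\<forall>x. \<theta> x = a" and x: "0 \<le> x"
    then have "\<theta> = (\<lambda>_. a)" by (simp add: fun_eq_iff)
    moreover have "\<exists>y>x. scale_integral s (\<lambda>_. a) y < \<infinity>"
      using scale_integral_const_finite[OF assms(5,6) a(1), of "x + 1"] by (intro exI[of _ "x + 1"]) simp
    ultimately show "measure M {\<omega>\<in>space M. running_sup Y (real_of_ereal (T \<omega>)) \<omega> > x} = exp_neg (scale_integral s (\<lambda>_. a) x)"
      using main[OF x] a(1) by simp
  qed (rule main)
qed

end
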